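(* Let $n\geq 2$ be an integer. Then: (1) $\chi^{\mathrm{ind}}_F(\mathbb{R}^n)=\chi_F(\mathbb{R}^n)=\chi(\mathbb{R}^n)$ for every (finite) forest $F$. (2) $\chi^{\mathrm{ind}}_{C_{2\ell}}(\mathbb{R}^n)=\chi_{C_{2\ell}}(\mathbb{R}^n)=\chi(\mathbb{R}^n)$ for $\ell=4$ and for every integer $\ell\geq 6$. (3) There exists $\ell_0=\ell_0(n)$ such that $\chi_{C_{2\ell+1}}(\mathbb{R}^n)=\lceil \chi(\mathbb{R}^n)/2\rceil$ for every integer $\ell\geq \ell_0$.
   Context: Graphs are finite and non-empty. For a graph $H=(V,E)$, a set $A\subseteq\mathbb{R}^n$ with $|A|=|V|$ is a unit-copy of $H$ if there is a bijection $f:V\to A$ such that $uv\in E$ implies $\|f(u)-f(v)\|=1$ (Euclidean norm); it is an induced unit-copy if moreover $uv\notin E$ implies $\|f(u)-f(v)\|\neq 1$. $\chi_H(\mathbb{R}^n)$ is the smallest positive integer $r$ such that there is an $r$-coloring of $\mathbb{R}^n$ with no monochromatic unit-copy of $H$; $\chi^{\mathrm{ind}}_H(\mathbb{R}^n)$ is defined analogously with induced unit-copies. $\chi(\mathbb{R}^n)$ is the chromatic number of $\mathbb{R}^n$, i.e. the least number of colors in a coloring of $\mathbb{R}^n$ with no two points at distance $1$ of the same color. $C_\ell$ denotes the cycle of length $\ell$. *)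

theory Defs
  imports "HOL-Analysis.Analysis"
begin

record 'v ugraph =
  verts :: "'v set"
  edges :: "'v set set"

text \<open>A graph without edges has a monochromatic unit-copy under every finite coloring,
  so its Euclidean chromatic numbers do not exist. A non-empty graph is therefore one
  that has an edge.\<close>

definition simple_graph :: "'v ugraph \<Rightarrow> bool" where
  "simple_graph H \<longleftrightarrow>
     finite (verts H) \<and> edges H \<noteq> {} \<and>
     (\<forall>e\<in>edges H. e \<subseteq> verts H \<and> card e = 2)"

definition is_cycle :: "'v ugraph \<Rightarrow> 'v list \<Rightarrow> bool" where
  "is_cycle H vs \<longleftrightarrow>
     length vs \<ge> 3 \<and> distinct vs \<and> set vs \<subseteq> verts H \<and>
     (\<forall>i<length vs. {vs ! i, vs ! (Suc i mod length vs)} \<in> edges H)"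

definition is_forest :: "'v ugraph \<Rightarrow> bool" where
  "is_forest H \<longleftrightarrow> simple_graph H \<and> (\<nexists>vs. is_cycle H vs)"

text \<open>This is the cycle of length \<open>k\<close> for \<open>k \<ge> 3\<close>; smaller \<open>k\<close> do not give a simple cycle.\<close>

definition cycle_graph :: "nat \<Rightarrow> nat ugraph" where
  "cycle_graph k = \<lparr>verts = {..<k}, edges = {{i, Suc i mod k} | i. i < k}\<rparr>"

definition unit_copy :: "'v ugraph \<Rightarrow> (real ^ 'n) set \<Rightarrow> bool" where
  "unit_copy H A \<longleftrightarrow>
     (\<exists>f. bij_betw f (verts H) A \<and>
          (\<forall>u\<in>verts H. \<forall>v\<in>verts H. {u, v} \<in> edges H \<longrightarrow> norm (f u - f v) = 1))"

definition induced_unit_copy :: "'v ugraph \<Rightarrow> (real ^ 'n) set \<Rightarrow> bool" where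
  "induced_unit_copy H A \<longleftrightarrow>
     (\<exists>f. bij_betw f (verts H) A \<and>
          (\<forall>u\<in>verts H. \<forall>v\<in>verts H. {u, v} \<in> edges H \<longrightarrow> norm (f u - f v) = 1) \<and>
          (\<forall>u\<in>verts H. \<forall>v\<in>verts H. {u, v} \<notin> edges H \<longrightarrow> norm (f u - f v) \<noteq> 1))"

definition coloring :: "nat \<Rightarrow> (real ^ 'n \<Rightarrow> nat) \<Rightarrow> bool" where
  "coloring r c \<longleftrightarrow> (\<forall>x. c x < r)"

definition monochromatic :: "(real ^ 'n \<Rightarrow> nat) \<Rightarrow> (real ^ 'n) set \<Rightarrow> bool" where
  "monochromatic c A \<longleftrightarrow> (\<exists>i. \<forall>x\<in>A. c x = i)"

text \<open>The space \<open>\<real>\<^sup>n\<close> enters through the index type \<open>'n\<close>, with \<open>n = CARD('n)\<close>.\<close>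

definition chi_graph :: "'n::finite itself \<Rightarrow> 'v ugraph \<Rightarrow> nat" where
  "chi_graph _ H =
     (LEAST r. r > 0 \<and>
        (\<exists>c :: real ^ 'n \<Rightarrow> nat. coloring r c \<and>
           (\<nexists>A. unit_copy H A \<and> monochromatic c A)))"

definition chi_ind_graph :: "'n::finite itself \<Rightarrow> 'v ugraph \<Rightarrow> nat" where
  "chi_ind_graph _ H =
     (LEAST r. r > 0 \<and>
        (\<exists>c :: real ^ 'n \<Rightarrow> nat. coloring r c \<and>
           (\<nexists>A. induced_unit_copy H A \<and> monochromatic c A)))"

definition chi_space :: "'n::finite itself \<Rightarrow> nat" where
  "chi_space _ =
     (LEAST r. \<exists>c :: real ^ 'n \<Rightarrow> nat. coloring r c \<and>
        (\<forall>x y. dist x y = 1 \<longrightarrow> c x \<noteq> c y))"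

end

theory Submission
  imports Defs
begin

text \<open>
  By compactness there is a finite \<open>V \<subseteq> \<real>\<^sup>n\<close> whose unit-distance graph is not \<open>r\<close>-colorable, for
  \<open>r < \<chi>(\<real>\<^sup>n)\<close>. For generic isometries \<open>T\<^sub>i\<close> the map \<open>w \<mapsto> \<Sum>\<^sub>i T\<^sub>i (w\<^sub>i)\<close> embeds the words \<open>V\<^sup>m\<close> in \<open>\<real>\<^sup>n\<close>
  so that two words are at distance \<open>1\<close> only if they differ in a single letter. In every \<open>r\<close>-coloring each
  line of \<open>V\<^sup>m\<close> contains a monochromatic edge, so the monochromatic graph on \<open>V\<^sup>m\<close> has unbounded
  average degree. Passing to large minimum degree, an induced forest is embedded greedily, each
  new edge using a fresh coordinate. For even cycles, double counting yields a base word \<open>b\<close>, letters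
  \<open>x\<close>, \<open>y\<close> and three disjoint sets of coordinates such that setting any transversal of them to \<open>x\<close>, or any two
  elements of a transversal, gives words of the same color; a cycle of \<open>l\<close> points and \<open>l\<close> lines
  in a three-dimensional grid then becomes an induced \<open>C\<^bsub>2l\<^esub>\<close>. Such cycles exist for \<open>l = 4\<close> and \<open>l \<ge> 6\<close>.
  With fewer than \<open>\<chi>/2\<close> colors each line even contains a monochromatic odd cycle of bounded length,
  and one edge of an even cycle is replaced by the long arc of such an odd cycle.
\<close>

section \<open>Finite colorings of space\<close>

text \<open>The upper bounds are short: a proper coloring with \<chi> colors has no monochromatic
  edge, and merging its colors in pairs leaves bipartite classes, which contain no odd cycle. The
  work lies in the lower bounds. The obstacle is that n is fixed, so there is no room for orthogonal
  copies of V. Generic position replaces orthogonality, at a price: about words that differ in two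
  or more letters it is only known that their distance is neither 0 nor 1. Hence neighbours in a
  copy must differ in exactly one letter, and that by a unit pair, while non-neighbours of an
  induced copy must differ in at least two letters. This demand explains the fresh coordinates used
  for forests and the incomparable sets used for cycles. A planar grid offers only cycles with an
  even number l of points; the third direction is there for odd l. An odd cycle found inside V may
  have chords of length 1, which is why nothing is said about induced copies of odd cycles.\<close>

text \<open>Cubes of side 1/K are colored periodically with period K + 2 along each axis. Points of
  one cube are closer than 1, and points in different cubes of one color differ by more than 1 in
  some coordinate. The existence of a finite proper coloring gives the \<open>LEAST\<close> in
  \<open>chi_space\<close> its meaning.\<close>

lemma finite_proper_coloring_exists:
  "\<exists>r (c :: real ^ 'n \<Rightarrow> nat). coloring r c \<and> (\<forall>x y. dist x y = 1 \<longrightarrow> c x \<noteq> c y)"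
proof -
  \<comment> \<open>K exceeds n, so n coordinate differences of at most 1/K add up to less than
    1.\<close>
  define K where "K = CARD('n) + 1"
  define h where "h = (\<lambda>(x :: real ^ 'n) i. \<lfloor>real K * x $ i\<rfloor> mod (int K + 2))"
  have K: "real K > 0" "real CARD('n) < real K" by (auto simp: K_def)
  have proper: "dist x y \<noteq> 1" if eq: "h x = h y" for x y
  proof (cases "\<forall>i. \<lfloor>real K * x $ i\<rfloor> = \<lfloor>real K * y $ i\<rfloor>")
    case True
    have "\<bar>(x - y) $ i\<bar> \<le> 1 / real K" for i
    proof -
      have "\<lfloor>real K * x $ i\<rfloor> = \<lfloor>real K * y $ i\<rfloor>" using True by blast
      then have "\<bar>real K * x $ i - real K * y $ i\<bar> \<le> 1" by linarith
      then have "real K * \<bar>x $ i - y $ i\<bar> \<le> 1"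
        using K by (metis abs_mult abs_of_pos right_diff_distrib)
      then show ?thesis using K by (simp add: field_simps)
    qed
    then have "norm (x - y) \<le> (\<Sum>i\<in>(UNIV::'n set). 1 / real K)"
      by (intro order_trans[OF norm_le_l1_cart] sum_mono) auto
    also have "\<dots> < 1" using K by simp
    finally show ?thesis by (simp add: dist_norm)
  next
    case False
    then obtain i where i: "\<lfloor>real K * x $ i\<rfloor> \<noteq> \<lfloor>real K * y $ i\<rfloor>" by blast
    have "\<lfloor>real K * x $ i\<rfloor> mod (int K + 2) = \<lfloor>real K * y $ i\<rfloor> mod (int K + 2)"
      using fun_cong[OF eq, of i] by (simp add: h_def)
    then have "(int K + 2) dvd \<lfloor>real K * x $ i\<rfloor> - \<lfloor>real K * y $ i\<rfloor>"
      by (simp add: mod_eq_dvd_iff)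
    then have "\<bar>int K + 2\<bar> \<le> \<bar>\<lfloor>real K * x $ i\<rfloor> - \<lfloor>real K * y $ i\<rfloor>\<bar>"
      using i by (intro dvd_imp_le_int) auto
    then have "real K + 1 \<le> \<bar>real K * x $ i - real K * y $ i\<bar>" by linarith
    also have "\<dots> = real K * \<bar>(x - y) $ i\<bar>"
      using K by (simp add: abs_mult flip: right_diff_distrib)
    also have "\<dots> \<le> real K * norm (x - y)"
      using component_le_norm_cart[of "x - y" i] K by (intro mult_left_mono) auto
    finally show ?thesis by (auto simp: dist_norm)
  qed
  have "h x \<in> Pi\<^sub>E UNIV (\<lambda>_. {0..<int K + 2})" for x by (auto simp: h_def)
  moreover have "finite (Pi\<^sub>E (UNIV::'n set) (\<lambda>_. {0..<int K + 2}))" by (intro finite_PiE) auto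
  ultimately have "finite (range h)" by (meson finite_subset image_subsetI)
  then obtain e where e: "bij_betw e (range h) {0..<card (range h)}"
    using ex_bij_betw_finite_nat by blast
  have "coloring (card (range h)) (e \<circ> h)"
    using bij_betwE[OF e] by (auto simp: coloring_def)
  moreover have "(e \<circ> h) x \<noteq> (e \<circ> h) y" if "dist x y = 1" for x y
    using proper that bij_betw_imp_inj_on[OF e] by (auto simp: inj_on_def)
  ultimately show ?thesis by blast
qed

text \<open>Tychonoff: the colorings form a compact product of finite discrete spaces, and each edge
  imposes a closed condition, so the finite intersection property applies.\<close>

theorem de_Bruijn_Erdos:
  fixes adj :: "'a \<Rightarrow> 'a \<Rightarrow> bool" and r :: nat
  assumes fin: "\<And>V. finite V \<Longrightarrow>
    \<exists>c. (\<forall>x\<in>V. c x < r) \<and> (\<forall>x\<in>V. \<forall>y\<in>V. adj x y \<longrightarrow> c x \<noteq> c y)"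
  shows "\<exists>c. (\<forall>x. c x < r) \<and> (\<forall>x y. adj x y \<longrightarrow> c x \<noteq> c y)"
proof -
  define X where "X = product_topology (\<lambda>_::'a. discrete_topology {..<r}) UNIV"
  define C where "C = (\<lambda>(x, y). {c \<in> topspace X. c x \<noteq> c y})"
  \<comment> \<open>\<open>topspace X\<close> is added so that a member of \<open>\<Inter>U\<close>
    has values below r even if there are no edges at all.\<close>
  define U where "U = insert (topspace X) (C ` {(x, y). adj x y})"
  have top: "topspace X = {c. \<forall>x. c x < r}" by (auto simp: X_def PiE_UNIV_domain)
  have "compact_space X"
    by (simp add: X_def compact_space_product_topology compact_space_discrete_topology)
  moreover have "closedin X S" if "S \<in> U" for S
  proof -
    have "closedin X {c \<in> topspace X. c x \<noteq> c y}" for x y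
    proof -
      have "continuous_map X (discrete_topology {..<r}) (\<lambda>c. c z)" for z
        unfolding X_def by (rule continuous_map_product_projection) simp
      then have cl: "closedin X {c \<in> topspace X. c z \<in> T}" if "T \<subseteq> {..<r}" for z T
        using that by (intro closedin_continuous_map_preimage[of X "discrete_topology {..<r}"]) auto
      \<comment> \<open>Closedness comes from splitting by the color i of x, a finite union of
        intersections of two preimages.\<close>
      have "closedin X (\<Union>((\<lambda>i. {c \<in> topspace X. c x \<in> {i}} \<inter> {c \<in> topspace X. c y \<in> {..<r} - {i}}) ` {..<r}))"
      proof (rule closedin_Union)
        fix S assume "S \<in> (\<lambda>i. {c \<in> topspace X. c x \<in> {i}} \<inter> {c \<in> topspace X. c y \<in> {..<r} - {i}}) ` {..<r}"
        then obtain i where "i < r" "S = {c \<in> topspace X. c x \<in> {i}} \<inter> {c \<in> topspace X. c y \<in> {..<r} - {i}}"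
          by blast
        then show "closedin X S" using cl[of "{i}" x] cl[of "{..<r} - {i}" y] by blast
      qed simp
      also have "\<Union>((\<lambda>i. {c \<in> topspace X. c x \<in> {i}} \<inter> {c \<in> topspace X. c y \<in> {..<r} - {i}}) ` {..<r}) =
        {c \<in> topspace X. c x \<noteq> c y}" by (auto simp: top)
      finally show ?thesis .
    qed
    then show ?thesis using that by (auto simp: U_def C_def)
  qed
  moreover have "\<Inter>\<F> \<noteq> {}" if "finite \<F>" "\<F> \<subseteq> U" for \<F>
  proof -
    have "finite (\<F> - {topspace X})" "\<F> - {topspace X} \<subseteq> C ` {(x, y). adj x y}"
      using that by (auto simp: U_def)
    then obtain P where P: "P \<subseteq> {(x, y). adj x y}" "finite P" "\<F> - {topspace X} = C ` P"
      by (meson finite_subset_image)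
    define Z where "Z = fst ` P \<union> snd ` P"
    have "finite Z" using P by (simp add: Z_def)
    from fin[OF this] obtain c where
      c: "\<And>x. x \<in> Z \<Longrightarrow> c x < r"
         "\<And>x y. x \<in> Z \<Longrightarrow> y \<in> Z \<Longrightarrow> adj x y \<Longrightarrow> c x \<noteq> c y"
      by blast
    \<comment> \<open>A one-point set has a coloring, so r is positive and the default color 0 is
      legal outside Z.\<close>
    from fin[of "{undefined}"] have r: "r > 0" by auto
    define c' where "c' = (\<lambda>x. if x \<in> Z then c x else 0)"
    have c'X: "c' \<in> topspace X" using c r by (auto simp: top c'_def)
    have "c' \<in> C p" if "p \<in> P" for p
    proof -
      obtain x y where p: "p = (x, y)" by force
      then have "x \<in> Z" "y \<in> Z" "adj x y"
        using that P(1) imageI[of p P fst] imageI[of p P snd] by (auto simp: Z_def)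
      then show ?thesis using c(2) c'X by (simp add: C_def p c'_def)
    qed
    then have "c' \<in> S" if "S \<in> \<F>" for S using P(3) c'X that by blast
    then show ?thesis by blast
  qed
  ultimately have "\<Inter>U \<noteq> {}" unfolding compact_space_fip by blast
  then obtain c where "c \<in> \<Inter>U" by blast
  then show ?thesis by (intro exI[of _ c]) (auto simp: U_def C_def top)
qed

section \<open>Odd cycles and bipartite graphs\<close>

lemma symp_relpowp:
  fixes E :: "'a \<Rightarrow> 'a \<Rightarrow> bool"
  assumes "symp E" "(E ^^ n) x y"
  shows "(E ^^ n) y x"
  using assms(2)
proof (induction n arbitrary: y)
  case (Suc n)
  then obtain z where "(E ^^ n) x z" "E z y" by auto
  then show ?case using Suc.IH assms(1) by (meson relpowp_Suc_I2 sympD)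
qed auto

text \<open>A shortest odd closed walk is a cycle: a repeated vertex would split it into two shorter
  closed walks, one of them odd. Irreflexivity rules out length 1.\<close>

lemma odd_cycle_of_odd_closed_walk:
  fixes E :: "'a \<Rightarrow> 'a \<Rightarrow> bool"
  assumes "irreflp E" "odd n" "(E ^^ n) x x"
  obtains p where "distinct p" "odd (length p)" "length p \<ge> 3"
    "\<And>i. i < length p \<Longrightarrow> E (p ! i) (p ! (Suc i mod length p))"
proof -
  define Q where "Q = (\<lambda>n. odd n \<and> (\<exists>x. (E ^^ n) x x))"
  define N where "N = (LEAST n. Q n)"
  have "Q n" using assms by (auto simp: Q_def)
  then have "Q N" and least: "\<And>k. k < N \<Longrightarrow> \<not> Q k"
    unfolding N_def by (auto intro: LeastI dest: not_less_Least)
  then obtain x0 where "odd N" "(E ^^ N) x0 x0" by (auto simp: Q_def)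
  then obtain f where f: "f 0 = x0" "f N = x0" "\<And>i. i < N \<Longrightarrow> E (f i) (f (Suc i))"
    unfolding relpowp_fun_conv by blast
  have walk: "(E ^^ (j - i)) (f i) (f j)" if "i \<le> j" "j \<le> N" for i j
    unfolding relpowp_fun_conv using that f(3) by (intro exI[of _ "\<lambda>k. f (i + k)"]) auto
  have "f i \<noteq> f j" if ij: "i < j" "j < N" for i j
  proof
    assume eq: "f i = f j"
    have "(E ^^ (j - i)) (f i) (f i)" using walk[of i j] ij eq by simp
    then have "\<not> odd (j - i)" using least[of "j - i"] ij by (metis Q_def diff_less_mono2 diff_le_self le_less_trans)
    have "(E ^^ i) x0 (f i)" using walk[of 0 i] ij f by simp
    moreover have "(E ^^ (N - j)) (f i) x0" using walk[of j N] ij f eq by simp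
    ultimately have "(E ^^ (i + (N - j))) x0 x0" by (rule relpowp_trans)
    moreover have "i + (N - j) < N" using ij by simp
    ultimately have "\<not> odd (i + (N - j))" using least[of "i + (N - j)"] unfolding Q_def by blast
    with \<open>\<not> odd (j - i)\<close> \<open>odd N\<close> ij show False by presburger
  qed
  then have inj: "inj_on f {..<N}" by (auto simp: inj_on_def) (metis nat_neq_iff)
  have "N \<noteq> 1" using f assms(1) by (auto simp: irreflp_def)
  with \<open>odd N\<close> have "N \<ge> 3" by presburger
  show ?thesis
  proof (rule that[of "map f [0..<N]"])
    show "distinct (map f [0..<N])" using inj by (simp add: distinct_map lessThan_atLeast0)
    fix i assume i: "i < length (map f [0..<N])"
    show "E (map f [0..<N] ! i) (map f [0..<N] ! (Suc i mod length (map f [0..<N])))"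
    proof (cases "Suc i = N")
      case True
      then show ?thesis using i f(1,2) f(3)[of i] by simp
    next
      case False
      then show ?thesis using i f(3)[of i] by simp
    qed
  qed (use \<open>odd N\<close> \<open>N \<ge> 3\<close> in auto)
qed

text \<open>The color is the parity of a walk to a root of the component. If the ends of an edge had
  walks of equal parity, these walks and the edge would form an odd closed walk.\<close>

theorem two_colorable_if_no_odd_cycle:
  fixes E :: "'a \<Rightarrow> 'a \<Rightarrow> bool"
  assumes "symp E" "irreflp E"
    and no_odd: "\<And>p. distinct p \<Longrightarrow> odd (length p) \<Longrightarrow> length p \<ge> 3 \<Longrightarrow>
      (\<And>i. i < length p \<Longrightarrow> E (p ! i) (p ! (Suc i mod length p))) \<Longrightarrow> False"
  shows "\<exists>h :: 'a \<Rightarrow> bool. \<forall>x y. E x y \<longrightarrow> h x \<noteq> h y"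
proof -
  \<comment> \<open>The choice depends only on the set of vertices reachable from x. Adjacent
    vertices have the same such set and hence the same root.\<close>
  define root where "root = (\<lambda>x. SOME y. E\<^sup>*\<^sup>* x y)"
  define h where "h = (\<lambda>x. \<exists>n. odd n \<and> (E ^^ n) x (root x))"
  have "E\<^sup>*\<^sup>* x (root x)" for x unfolding root_def by (rule someI[of _ x]) simp
  then have walk: "\<exists>n. (E ^^ n) x (root x)" for x by (simp add: rtranclp_power)
  have "h x \<noteq> h y" if E: "E x y" for x y
  proof
    assume eq: "h x = h y"
    have "E y x" using E assms(1) by (meson sympD)
    then have "E\<^sup>*\<^sup>* x = E\<^sup>*\<^sup>* y"
      using E by (intro ext) (meson converse_rtranclp_into_rtranclp)
    then have root: "root y = root x" by (simp add: root_def)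
    obtain n m where nm: "(E ^^ n) x (root x)" "(E ^^ m) y (root x)" "odd n \<longleftrightarrow> odd m"
      using eq walk[of x] walk[of y] unfolding h_def root by blast
    have "(E ^^ (n + m)) x y"
      using nm symp_relpowp[OF assms(1)] by (blast intro: relpowp_trans)
    then have "(E ^^ (Suc (n + m))) x x" using \<open>E y x\<close> by (rule relpowp_Suc_I)
    moreover have "odd (Suc (n + m))" using nm(3) by simp
    ultimately obtain p where "distinct p" "odd (length p)" "length p \<ge> 3"
      "\<And>i. i < length p \<Longrightarrow> E (p ! i) (p ! (Suc i mod length p))"
      using odd_cycle_of_odd_closed_walk[OF assms(2)] by metis
    then show False using no_odd by blast
  qed
  then show ?thesis by blast
qed

section \<open>Generic isometries\<close>

text \<open>Dimension at least 2 enters the whole development here: if \<open>l \<noteq> 0\<close>,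
  a vector orthogonal to \<open>d\<close> removes the second summand. On a line the form is a
  constant multiple of a^2, and the constant may be 0.\<close>

lemma quadratic_form_nonvanishing:
  fixes p d :: "'a::euclidean_space"
  assumes "DIM('a) \<ge> 2" "p \<noteq> 0" "d \<noteq> 0"
  shows "\<exists>a. l * (a \<bullet> a) - 2 * (a \<bullet> d) * (a \<bullet> p) \<noteq> 0"
proof (cases "l = 0")
  case True
  show ?thesis
  proof (cases "p \<bullet> d = 0")
    case True
    then show ?thesis using \<open>l = 0\<close> assms
      by (intro exI[of _ "p + d"]) (simp add: inner_add_left inner_commute[of d p])
  next
    case False
    then show ?thesis using \<open>l = 0\<close> assms by (intro exI[of _ d]) (simp add: inner_commute)
  qed
next
  case False
  obtain a where "a \<noteq> 0" "orthogonal d a" using orthogonal_to_vector_exists[OF assms(1), of d]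
    by (auto simp: orthogonal_commute)
  then show ?thesis using False by (intro exI[of _ a]) (simp add: orthogonal_def inner_commute)
qed

text \<open>On the line a + t b every form restricts to a polynomial in t. The old forms do not
  vanish at a and the new one does not vanish at b, so none of these polynomials is zero, and some t
  avoids their finitely many roots.\<close>

lemma quadratic_forms_common_nonvanishing:
  fixes S :: "(real \<times> 'a::euclidean_space \<times> 'a) set"
  assumes "finite S" "DIM('a) \<ge> 2" "\<And>l p d. (l, p, d) \<in> S \<Longrightarrow> p \<noteq> 0 \<and> d \<noteq> 0"
  shows "\<exists>a. \<forall>(l, p, d)\<in>S. l * (a \<bullet> a) - 2 * (a \<bullet> d) * (a \<bullet> p) \<noteq> 0"
  using assms(1,3)
proof (induction S rule: finite_induct)
  case (insert q S)
  define Q where "Q = (\<lambda>(l, p, d) (a::'a). l * (a \<bullet> a) - 2 * (a \<bullet> d) * (a \<bullet> p))"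
  obtain a where a: "\<And>q. q \<in> S \<Longrightarrow> Q q a \<noteq> 0"
    using insert unfolding Q_def by fastforce
  obtain l p d where q: "q = (l, p, d)" by (cases q)
  obtain b where b: "Q q b \<noteq> 0"
    using quadratic_form_nonvanishing[OF assms(2), of p d l] insert.prems[of l p d] q
    unfolding Q_def by auto
  \<comment> \<open>The middle coefficient is the polarization of the form; the outer ones are its
    values at a and b.\<close>
  define P where "P = (\<lambda>(l, p, d). [:Q (l, p, d) a,
    2 * l * (a \<bullet> b) - 2 * (a \<bullet> d) * (b \<bullet> p) - 2 * (b \<bullet> d) * (a \<bullet> p), Q (l, p, d) b:])"
  have P: "poly (P q) t = Q q (a + t *\<^sub>R b)" for q t
    by (cases q) (simp add: P_def Q_def inner_add_left inner_add_right inner_commute[of b a]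
        algebra_simps power2_eq_square)
  have "P q' \<noteq> 0" if "q' \<in> insert q S" for q'
    using that a b by (cases q') (auto simp: P_def)
  then have "finite (\<Union>q'\<in>insert q S. {t. poly (P q') t = 0})"
    using insert.hyps by (intro finite_UN_I) (auto intro: poly_roots_finite)
  then obtain t where "t \<notin> (\<Union>q'\<in>insert q S. {t. poly (P q') t = 0})"
    using ex_new_if_finite infinite_UNIV_char_0 by blast
  then have "\<forall>q'\<in>insert q S. Q q' (a + t *\<^sub>R b) \<noteq> 0" by (auto simp: P)
  then show ?case by (intro exI[of _ "a + t *\<^sub>R b"]) (auto simp: Q_def)
qed simp

text \<open>A single hyperplane reflection suffices: each forbidden equation on \<open>norm (p + T d)\<close> becomes
  the vanishing of a non-zero quadratic form in the normal vector.\<close>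

lemma generic_isometry:
  fixes P D :: "'a::euclidean_space set"
  assumes "finite P" "finite D" "0 \<notin> P" "0 \<notin> D" "DIM('a) \<ge> 2"
  shows "\<exists>T. linear T \<and> (\<forall>v. norm (T v) = norm v) \<and>
    (\<forall>p\<in>P. \<forall>d\<in>D. norm (p + T d) \<noteq> 0 \<and> norm (p + T d) \<noteq> 1)"
proof -
  \<comment> \<open>If T is the reflection with normal a, then the square of |p + T d| is that of |p
    + d| minus 4 (a . d) (a . p) / (a . a). Equating this with s, which is 0 or 1, and multiplying
    by (a . a) / 2 gives the forms collected here.\<close>
  define S where "S = (\<lambda>(s, p, d). (((p + d) \<bullet> (p + d) - s) / 2, p, d)) ` ({0, 1::real} \<times> P \<times> D)"
  have "\<exists>a. \<forall>(l, p, d)\<in>S. l * (a \<bullet> a) - 2 * (a \<bullet> d) * (a \<bullet> p) \<noteq> 0"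
    using assms by (intro quadratic_forms_common_nonvanishing) (auto simp: S_def)
  then obtain a where a: "\<And>l p d. (l, p, d) \<in> S \<Longrightarrow> l * (a \<bullet> a) - 2 * (a \<bullet> d) * (a \<bullet> p) \<noteq> 0"
    by blast
  define T where "T = (\<lambda>v. v - (2 * (a \<bullet> v) / (a \<bullet> a)) *\<^sub>R a)"
  have "linear T" unfolding T_def
    by (intro linearI) (simp_all add: inner_add_right algebra_simps add_divide_distrib)
  moreover have iso: "norm (T v) = norm v" for v
  proof -
    have "T v \<bullet> T v = v \<bullet> v"
      by (cases "a = 0") (simp_all add: T_def inner_diff_left inner_diff_right inner_commute[of v a])
    then show ?thesis by (simp add: norm_eq)
  qed
  moreover have "norm (p + T d) \<noteq> 0 \<and> norm (p + T d) \<noteq> 1" if "p \<in> P" "d \<in> D" for p d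
  proof -
    have *: "((p + d) \<bullet> (p + d) - s) / 2 * (a \<bullet> a) - 2 * (a \<bullet> d) * (a \<bullet> p) \<noteq> 0" if "s \<in> {0, 1}" for s
      using that \<open>p \<in> P\<close> \<open>d \<in> D\<close> by (intro a) (force simp: S_def)
    \<comment> \<open>The form is nonzero at a, so a is not 0 and T is a genuine reflection; for a =
      0 division by zero would make T the identity.\<close>
    then have "a \<bullet> a \<noteq> 0" by (metis inner_eq_zero_iff inner_zero_left insertI1 mult_zero_right diff_zero)
    have "T d \<bullet> T d = d \<bullet> d" using iso[of d] by (simp add: norm_eq)
    moreover have "p \<bullet> T d = p \<bullet> d - 2 * (a \<bullet> d) / (a \<bullet> a) * (a \<bullet> p)"
      by (simp add: T_def inner_diff_right inner_commute)
    ultimately have "(p + T d) \<bullet> (p + T d) = (p + d) \<bullet> (p + d) - 4 * (a \<bullet> d) * (a \<bullet> p) / (a \<bullet> a)"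
      by (simp add: inner_add_left inner_add_right inner_commute[of d p] inner_commute[of "T d" p])
    then have "(p + T d) \<bullet> (p + T d) \<noteq> s" if "s \<in> {0, 1}" for s
      using *[OF that] \<open>a \<bullet> a \<noteq> 0\<close> by (auto simp: field_simps)
    from this[of 0] this[of 1] have "(norm (p + T d))\<^sup>2 \<noteq> 0" "(norm (p + T d))\<^sup>2 \<noteq> 1"
      by (auto simp: power2_norm_eq_inner)
    then show ?thesis by auto
  qed
  ultimately show ?thesis by blast
qed

text \<open>Each new isometry is generic against the finitely many differences of points built so
  far. Excluding distance 0 along with 1 carries the induction: it keeps these differences nonzero,
  as \<open>generic_isometry\<close> demands.\<close>

lemma generic_isometries:
  fixes V :: "'a::euclidean_space set" and m :: nat
  assumes "finite V" "DIM('a) \<ge> 2"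
  shows "\<exists>T :: nat \<Rightarrow> 'a \<Rightarrow> 'a. (\<forall>i. linear (T i)) \<and> (\<forall>i v. norm (T i v) = norm v) \<and>
    (\<forall>w w'. (\<forall>i<m. w i \<in> V \<and> w' i \<in> V) \<and> 2 \<le> card {i. i < m \<and> w i \<noteq> w' i} \<longrightarrow>
      norm ((\<Sum>i<m. T i (w i)) - (\<Sum>i<m. T i (w' i))) \<notin> {0, 1})"
proof (induction m)
  case 0
  show ?case by (intro exI[of _ "\<lambda>_ v. v"]) (auto simp: linear_ident)
next
  case (Suc m)
  then obtain T :: "nat \<Rightarrow> 'a \<Rightarrow> 'a" where T: "\<And>i. linear (T i)" "\<And>i v. norm (T i v) = norm v"
    and gen: "\<And>w w'. (\<forall>i<m. w i \<in> V \<and> w' i \<in> V) \<Longrightarrow> 2 \<le> card {i. i < m \<and> w i \<noteq> w' i} \<Longrightarrow>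
      norm ((\<Sum>i<m. T i (w i)) - (\<Sum>i<m. T i (w' i))) \<notin> {0, 1}" by blast
  define F where "F = (\<lambda>w. \<Sum>i<m. T i (w i))"
  define W where "W = Pi\<^sub>E {..<m} (\<lambda>_. V)"
  define P where "P = (\<lambda>(w, w'). F w - F w') ` (W \<times> W) - {0}"
  define D where "D = (\<lambda>(v, v'). v - v') ` (V \<times> V) - {0}"
  have "finite W" unfolding W_def using assms by (intro finite_PiE) auto
  then have "finite P" "finite D" "0 \<notin> P" "0 \<notin> D" using assms by (auto simp: P_def D_def)
  from generic_isometry[OF this assms(2)] obtain R where R: "linear R" "\<And>v. norm (R v) = norm v"
    "\<And>p d. p \<in> P \<Longrightarrow> d \<in> D \<Longrightarrow> norm (p + R d) \<notin> {0, 1}" by auto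
  \<comment> \<open>Only the letters before m matter, and the restricted words form a finite set, so
    arbitrary w and w' are covered by P.\<close>
  have FP: "F w - F w' = 0 \<or> F w - F w' \<in> P" if "\<forall>i<m. w i \<in> V \<and> w' i \<in> V" for w w'
  proof -
    have "F w = F (restrict w {..<m})" "F w' = F (restrict w' {..<m})" by (simp_all add: F_def)
    moreover have "restrict w {..<m} \<in> W" "restrict w' {..<m} \<in> W" using that by (auto simp: W_def)
    ultimately show ?thesis unfolding P_def by force
  qed
  have "norm ((\<Sum>i<Suc m. (T(m := R)) i (w i)) - (\<Sum>i<Suc m. (T(m := R)) i (w' i))) \<notin> {0, 1}"
    if w: "\<forall>i<Suc m. w i \<in> V \<and> w' i \<in> V" and c: "2 \<le> card {i. i < Suc m \<and> w i \<noteq> w' i}" for w w'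
  proof -
    have sum: "(\<Sum>i<Suc m. (T(m := R)) i (v i)) = F v + R (v m)" for v by (simp add: F_def)
    have eq: "(\<Sum>i<Suc m. (T(m := R)) i (w i)) - (\<Sum>i<Suc m. (T(m := R)) i (w' i))
      = (F w - F w') + R (w m - w' m)"
      unfolding sum using R(1) by (simp add: linear_diff)
    show ?thesis
    proof (cases "w m = w' m")
      case True
      then have "{i. i < Suc m \<and> w i \<noteq> w' i} = {i. i < m \<and> w i \<noteq> w' i}" by (auto simp: less_Suc_eq)
      then show ?thesis unfolding eq using gen[of w w'] w c True R(1) by (simp add: F_def linear_0)
    next
      case False
      then have Suc: "{i. i < Suc m \<and> w i \<noteq> w' i} = insert m {i. i < m \<and> w i \<noteq> w' i}"
        by (auto simp: less_Suc_eq)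
      have c1: "1 \<le> card {i. i < m \<and> w i \<noteq> w' i}" using c by (simp add: Suc)
      \<comment> \<open>A single differing letter gives a difference of the same norm as that of the
        letters; more of them fall under the induction hypothesis.\<close>
      have "F w - F w' \<noteq> 0"
      proof (cases "card {i. i < m \<and> w i \<noteq> w' i} = 1")
        case True
        then obtain j where j: "{i. i < m \<and> w i \<noteq> w' i} = {j}" by (meson card_1_singletonE)
        have "F w - F w' = (\<Sum>i<m. T i (w i - w' i))"
          using T by (simp add: F_def linear_diff sum_subtractf)
        also have "\<dots> = (\<Sum>i\<in>{j}. T i (w i - w' i))"
          using j T(1) by (intro sum.mono_neutral_right) (auto simp: linear_0)
        finally have "norm (F w - F w') = norm (w j - w' j)" using T by simp
        moreover have "j \<in> {i. i < m \<and> w i \<noteq> w' i}" unfolding j by simp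
        ultimately show ?thesis by auto
      next
        case False
        then show ?thesis using gen[of w w'] w c1 by (auto simp: F_def)
      qed
      then have "F w - F w' \<in> P" using FP[of w w'] w by auto
      moreover have "w m - w' m \<in> D" using w False by (force simp: D_def)
      ultimately show ?thesis unfolding eq using R(3) by blast
    qed
  qed
  then show ?case using T R(1,2) by (intro exI[of _ "T(m := R)"]) auto
qed

section \<open>Dense relations\<close>

text \<open>Terms below c/2 account for at most half of the sum; the other half is made up of terms
  of size at most M.\<close>

lemma card_large_values:
  fixes f :: "'a \<Rightarrow> real" and c M :: real
  assumes "finite S" "c \<ge> 0" "\<And>x. x \<in> S \<Longrightarrow> f x \<le> M" "c * card S \<le> (\<Sum>x\<in>S. f x)"
  shows "c / 2 * card S \<le> M * card {x\<in>S. c / 2 \<le> f x}"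
proof -
  have "(\<Sum>x\<in>S. f x) = (\<Sum>x | x \<in> S \<and> c / 2 \<le> f x. f x) + (\<Sum>x\<in>S - {x. c / 2 \<le> f x}. f x)"
    using assms(1) by (subst sum.union_disjoint[symmetric]) (auto intro!: sum.cong)
  also have "\<dots> \<le> (\<Sum>x | x \<in> S \<and> c / 2 \<le> f x. M) + (\<Sum>x\<in>S - {x. c / 2 \<le> f x}. c / 2)"
    by (rule add_mono; rule sum_mono) (use assms(3) in force)+
  also have "\<dots> \<le> M * card {x\<in>S. c / 2 \<le> f x} + c / 2 * card S"
  proof -
    have "card (S - {x. c / 2 \<le> f x}) \<le> card S" using assms(1) by (intro card_mono) auto
    then have "c / 2 * card (S - {x. c / 2 \<le> f x}) \<le> c / 2 * card S"
      using assms(2) by (intro mult_left_mono) auto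
    then show ?thesis by (simp add: mult.commute)
  qed
  finally show ?thesis using assms(4) by (simp add: field_simps)
qed

lemma sum_card_swap:
  assumes "finite X" "finite Z"
  shows "(\<Sum>x\<in>X. card {z\<in>Z. R x z}) = (\<Sum>z\<in>Z. card {x\<in>X. R x z})"
proof -
  have "(\<Sum>x\<in>X. card {z\<in>Z. R x z}) = (\<Sum>x\<in>X. \<Sum>z\<in>Z. if R x z then 1 else 0)"
    by (simp only: card_eq_sum sum.inter_filter[OF assms(2)])
  also have "\<dots> = (\<Sum>z\<in>Z. \<Sum>x\<in>X. if R x z then 1 else 0)" by (rule sum.swap)
  also have "\<dots> = (\<Sum>z\<in>Z. card {x\<in>X. R x z})"
    by (simp only: card_eq_sum sum.inter_filter[OF assms(1)])
  finally show ?thesis .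
qed

lemma exists_ge_average:
  fixes f :: "'a \<Rightarrow> real" and c :: real
  assumes "finite S" "S \<noteq> {}" "c * card S \<le> (\<Sum>x\<in>S. f x)"
  shows "\<exists>x\<in>S. c \<le> f x"
proof (rule ccontr)
  assume "\<not> ?thesis"
  then have "(\<Sum>x\<in>S. f x) < (\<Sum>x\<in>S. c)" using assms by (intro sum_strict_mono) auto
  then show False using assms by (simp add: mult.commute)
qed

text \<open>The one-sided Kovari-Sos-Turan argument. \<delta> and s must not depend on the sizes of
  X and Z, so the pigeonhole is applied not to all t-subsets of Z but to those of a sample Z' of
  fixed size q.\<close>

lemma dense_relation_common_subset:
  fixes \<gamma> :: real
  assumes "\<gamma> > 0"
  obtains \<delta> :: real and s :: nat where "\<delta> > 0"
    and "\<forall>(X :: 'a set) (Z :: 'b set) R. finite X \<longrightarrow> finite Z \<longrightarrow> s \<le> card Z \<longrightarrow>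
      \<gamma> * card X * card Z \<le> (\<Sum>x\<in>X. card {z\<in>Z. R x z}) \<longrightarrow>
      (\<exists>A\<subseteq>Z. card A = t \<and> \<delta> * card X \<le> card {x\<in>X. \<forall>z\<in>A. R x z})"
proof -
  \<comment> \<open>A share \<gamma>/2 of Z, hence at least q elements, have \<gamma>/2
    \<open>card X\<close> partners each. Then a share \<gamma>/4 of X has at least \<gamma> q/4
    \<ge> t partners in the sample, and at most 2^q subsets of the sample compete.\<close>
  define q where "q = max t (nat \<lceil>4 * t / \<gamma>\<rceil>) + 1"
  define s where "s = nat \<lceil>2 * q / \<gamma>\<rceil> + q"
  define \<delta> where "\<delta> = \<gamma> / 4 / 2 ^ q"
  have q: "t \<le> q" "4 * t / \<gamma> \<le> q" "0 < q" unfolding q_def by linarith+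
  have s: "q \<le> s" "2 * q / \<gamma> \<le> s" unfolding s_def by linarith+
  have "\<exists>A\<subseteq>Z. card A = t \<and> \<delta> * card X \<le> card {x\<in>X. \<forall>z\<in>A. R x z}"
    if fin: "finite X" "finite Z" and Z: "s \<le> card Z"
      and dense: "\<gamma> * card X * card Z \<le> (\<Sum>x\<in>X. card {z\<in>Z. R x z})"
    for X :: "'a set" and Z :: "'b set" and R
  proof (cases "X = {}")
    case True
    have "t \<le> card Z" using Z q s by simp
    then obtain A where "A \<subseteq> Z" "card A = t" by (rule obtain_subset_with_card_n)
    then show ?thesis using True by auto
  next
    case False
    then have X: "card X > 0" using fin by (simp add: card_gt_0_iff)
    define N where "N = (\<lambda>z. real (card {x\<in>X. R x z}))"
    have le: "N z \<le> card X" for z unfolding N_def using fin by (auto intro: card_mono)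
    have "\<gamma> * card X * card Z \<le> (\<Sum>z\<in>Z. N z)"
      using dense sum_card_swap[OF fin, of R] unfolding N_def by (simp flip: of_nat_sum)
    then have "\<gamma> * card X / 2 * card Z \<le> real (card X) * card {z\<in>Z. \<gamma> * card X / 2 \<le> N z}"
      using assms fin le by (intro card_large_values[of Z "\<gamma> * card X"]) simp_all
    then have "\<gamma> / 2 * card Z \<le> card {z\<in>Z. \<gamma> * card X / 2 \<le> N z}"
      using X by (simp add: field_simps)
    moreover have "q \<le> \<gamma> / 2 * card Z"
    proof -
      have "q \<le> \<gamma> / 2 * s" using s assms by (simp add: field_simps)
      also have "\<dots> \<le> \<gamma> / 2 * card Z" using Z assms by (intro mult_left_mono) auto
      finally show ?thesis .
    qed
    ultimately have "q \<le> card {z\<in>Z. \<gamma> * card X / 2 \<le> N z}" by linarith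
    then obtain Z' where "Z' \<subseteq> {z\<in>Z. \<gamma> * card X / 2 \<le> N z}" and cZ': "card Z' = q" and fZ': "finite Z'"
      by (rule obtain_subset_with_card_n)
    then have Z': "Z' \<subseteq> Z" "\<And>z. z \<in> Z' \<Longrightarrow> \<gamma> * card X / 2 \<le> N z" by auto
    define K where "K = (\<lambda>x. {z\<in>Z'. R x z})"
    have "\<gamma> * q / 2 * card X = (\<Sum>z\<in>Z'. \<gamma> * card X / 2)" by (simp add: cZ')
    also have "\<dots> \<le> (\<Sum>z\<in>Z'. N z)" using Z'(2) by (intro sum_mono)
    also have "\<dots> = (\<Sum>x\<in>X. real (card (K x)))"
      using sum_card_swap[OF fin(1) fZ', of R] unfolding N_def K_def by (simp flip: of_nat_sum)
    finally have "\<gamma> * q / 2 / 2 * card X \<le> real q * card {x\<in>X. \<gamma> * q / 2 / 2 \<le> card (K x)}"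
      using assms fin fZ' unfolding K_def cZ'[symmetric]
      by (intro card_large_values) (auto intro: card_mono)
    moreover have "{x\<in>X. \<gamma> * q / 2 / 2 \<le> card (K x)} \<subseteq> (\<Union>A\<in>{A. A \<subseteq> Z' \<and> card A = t}. {x\<in>X. \<forall>z\<in>A. R x z})"
    proof
      fix x assume x: "x \<in> {x\<in>X. \<gamma> * q / 2 / 2 \<le> card (K x)}"
      moreover have "t \<le> \<gamma> * q / 2 / 2" using q assms by (simp add: field_simps)
      ultimately have "t \<le> card (K x)" by simp
      then obtain A where "A \<subseteq> K x" "card A = t" by (rule obtain_subset_with_card_n)
      then show "x \<in> (\<Union>A\<in>{A. A \<subseteq> Z' \<and> card A = t}. {x\<in>X. \<forall>z\<in>A. R x z})"
        using x by (auto simp: K_def)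
    qed
    then have "card {x\<in>X. \<gamma> * q / 2 / 2 \<le> card (K x)}
      \<le> card (\<Union>A\<in>{A. A \<subseteq> Z' \<and> card A = t}. {x\<in>X. \<forall>z\<in>A. R x z})"
      using fin fZ' by (intro card_mono) auto
    also have "\<dots> \<le> (\<Sum>A\<in>{A. A \<subseteq> Z' \<and> card A = t}. card {x\<in>X. \<forall>z\<in>A. R x z})"
      using fZ' by (intro card_UN_le) auto
    ultimately have "\<gamma> * q / 2 / 2 * card X \<le> real q * (\<Sum>A\<in>{A. A \<subseteq> Z' \<and> card A = t}. card {x\<in>X. \<forall>z\<in>A. R x z})"
      by (meson mult_left_mono of_nat_0_le_iff of_nat_mono order_trans)
    then have sum: "\<gamma> / 4 * card X \<le> (\<Sum>A\<in>{A. A \<subseteq> Z' \<and> card A = t}. real (card {x\<in>X. \<forall>z\<in>A. R x z}))"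
      using q(3) by (simp add: field_simps)
    have "card {A. A \<subseteq> Z' \<and> card A = t} \<le> card (Pow Z')" using fZ' by (intro card_mono) auto
    then have "card {A. A \<subseteq> Z' \<and> card A = t} \<le> 2 ^ q" using fZ' cZ' by (simp add: card_Pow)
    then have "real (card {A. A \<subseteq> Z' \<and> card A = t}) \<le> 2 ^ q"
      by (metis of_nat_le_iff of_nat_numeral of_nat_power)
    then have "\<delta> * card X * card {A. A \<subseteq> Z' \<and> card A = t} \<le> \<delta> * card X * 2 ^ q"
      using assms by (intro mult_left_mono) (auto simp: \<delta>_def)
    also have "\<dots> \<le> \<gamma> / 4 * card X"
      using q(3) assms by (simp add: \<delta>_def field_simps)
    also note sum
    finally have "\<exists>A\<in>{A. A \<subseteq> Z' \<and> card A = t}. \<delta> * card X \<le> card {x\<in>X. \<forall>z\<in>A. R x z}"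
      using fZ' cZ' q(1) by (intro exists_ge_average) (auto elim: obtain_subset_with_card_n[of t Z'])
    then show ?thesis using Z'(1) by blast
  qed
  moreover have "\<delta> > 0" using assms q by (simp add: \<delta>_def)
  ultimately show ?thesis by (intro that[of \<delta> s]) auto
qed

text \<open>Erdos' theorem on complete tripartite parts of dense triple systems. R is viewed as a
  relation between pairs and third coordinates, which yields C and a dense set of pairs; that set is
  treated in the same way. The three sets may overlap at this stage.\<close>

theorem dense_triple_relation_complete:
  fixes \<gamma> :: real
  assumes "\<gamma> > 0"
  shows "\<exists>M::nat. \<forall>m\<ge>M. \<forall>R. \<gamma> * real m ^ 3 \<le> card {(i, j, k). i < m \<and> j < m \<and> k < m \<and> R i j k} \<longrightarrow>
    (\<exists>A B C. A \<subseteq> {..<m} \<and> B \<subseteq> {..<m} \<and> C \<subseteq> {..<m} \<and> card A = t \<and> card B = t \<and> card C = t \<and>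
      (\<forall>i\<in>A. \<forall>j\<in>B. \<forall>k\<in>C. R i j k))"
proof -
  obtain \<delta> :: real and s where \<delta>: "\<delta> > 0" and one: "\<forall>(X :: (nat \<times> nat) set) (Z :: nat set) R.
    finite X \<longrightarrow> finite Z \<longrightarrow> s \<le> card Z \<longrightarrow> \<gamma> * card X * card Z \<le> (\<Sum>x\<in>X. card {z\<in>Z. R x z}) \<longrightarrow>
      (\<exists>A\<subseteq>Z. card A = t \<and> \<delta> * card X \<le> card {x\<in>X. \<forall>z\<in>A. R x z})"
    using dense_relation_common_subset[OF assms, of t, where 'a = "nat \<times> nat" and 'b = nat] .
  obtain \<delta>' :: real and s' where \<delta>': "\<delta>' > 0" and two: "\<forall>(X :: nat set) (Z :: nat set) R.
    finite X \<longrightarrow> finite Z \<longrightarrow> s' \<le> card Z \<longrightarrow> \<delta> * card X * card Z \<le> (\<Sum>x\<in>X. card {z\<in>Z. R x z}) \<longrightarrow>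
      (\<exists>A\<subseteq>Z. card A = t \<and> \<delta>' * card X \<le> card {x\<in>X. \<forall>z\<in>A. R x z})"
    using dense_relation_common_subset[OF \<delta>, of t, where 'a = nat and 'b = nat] .
  \<comment> \<open>s and s' permit the two applications; the last summand ensures that a share
    \<delta>' of the first coordinates contains t of them.\<close>
  define M where "M = s + s' + nat \<lceil>t / \<delta>'\<rceil>"
  show ?thesis
  proof (intro exI[of _ M] allI impI)
    fix m R assume m: "m \<ge> M" and dense: "\<gamma> * real m ^ 3 \<le> card {(i, j, k). i < m \<and> j < m \<and> k < m \<and> R i j k}"
    have "s \<le> m" "s' \<le> m" using m by (simp_all add: M_def)
    have "nat \<lceil>t / \<delta>'\<rceil> \<le> m" using m unfolding M_def by (rule add_leD2)
    then have "t / \<delta>' \<le> m" by linarith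
    have "{(i, j, k). i < m \<and> j < m \<and> k < m \<and> R i j k} =
      (\<lambda>((i, j), k). (i, j, k)) ` (SIGMA x:{..<m} \<times> {..<m}. {k\<in>{..<m}. R (fst x) (snd x) k})"
      by force
    then have "card {(i, j, k). i < m \<and> j < m \<and> k < m \<and> R i j k} =
      card (SIGMA x:{..<m} \<times> {..<m}. {k\<in>{..<m}. R (fst x) (snd x) k})"
      by (simp add: card_image inj_on_def split_beta prod_eq_iff)
    also have "\<dots> = (\<Sum>x\<in>{..<m} \<times> {..<m}. card {k\<in>{..<m}. R (fst x) (snd x) k})"
      by (rule card_SigmaI) auto
    finally have "\<exists>C\<subseteq>{..<m}. card C = t \<and> \<delta> * card ({..<m} \<times> {..<m}) \<le>
      card {x\<in>{..<m} \<times> {..<m}. \<forall>k\<in>C. R (fst x) (snd x) k}"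
      using dense \<open>s \<le> m\<close> by (intro one[rule_format]) (auto simp: power3_eq_cube mult.assoc)
    then obtain C where C: "C \<subseteq> {..<m}" "card C = t"
      "\<delta> * m * m \<le> card {x\<in>{..<m} \<times> {..<m}. \<forall>k\<in>C. R (fst x) (snd x) k}"
      by (auto simp: mult.assoc)
    have "{x\<in>{..<m} \<times> {..<m}. \<forall>k\<in>C. R (fst x) (snd x) k} =
      (SIGMA i:{..<m}. {j\<in>{..<m}. \<forall>k\<in>C. R i j k})" by auto
    then have "card {x\<in>{..<m} \<times> {..<m}. \<forall>k\<in>C. R (fst x) (snd x) k} =
      (\<Sum>i\<in>{..<m}. card {j\<in>{..<m}. \<forall>k\<in>C. R i j k})" by (simp add: card_SigmaI)
    then have "\<exists>B\<subseteq>{..<m}. card B = t \<and> \<delta>' * card {..<m} \<le> card {i\<in>{..<m}. \<forall>j\<in>B. \<forall>k\<in>C. R i j k}"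
      using C(3) \<open>s' \<le> m\<close> by (intro two[rule_format]) auto
    then obtain B where B: "B \<subseteq> {..<m}" "card B = t"
      "\<delta>' * m \<le> card {i\<in>{..<m}. \<forall>j\<in>B. \<forall>k\<in>C. R i j k}" by auto
    have "t \<le> \<delta>' * m" using \<open>t / \<delta>' \<le> m\<close> \<delta>' by (simp add: field_simps)
    then have "t \<le> card {i\<in>{..<m}. \<forall>j\<in>B. \<forall>k\<in>C. R i j k}" using B(3) by linarith
    then obtain A where "A \<subseteq> {i\<in>{..<m}. \<forall>j\<in>B. \<forall>k\<in>C. R i j k}" "card A = t"
      by (rule obtain_subset_with_card_n)
    then show "\<exists>A B C. A \<subseteq> {..<m} \<and> B \<subseteq> {..<m} \<and> C \<subseteq> {..<m} \<and> card A = t \<and> card B = t \<and> card C = t \<and>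
      (\<forall>i\<in>A. \<forall>j\<in>B. \<forall>k\<in>C. R i j k)"
      using B C by (intro exI[of _ A] exI[of _ B] exI[of _ C]) auto
  qed
qed

section \<open>Positions that are good in many words\<close>

text \<open>Every word arises from a good one by overwriting the letter at i, and a good word yields
  at most \<open>card V\<close> words in this way.\<close>

lemma card_words_le_good_words:
  assumes "finite V" "i < (m::nat)" and W: "W = Pi\<^sub>E {..<m} (\<lambda>_. V)"
    and good: "\<And>w. w \<in> W \<Longrightarrow> \<exists>v\<in>V. P (w(i := v))"
  shows "card W \<le> card V * card {w\<in>W. P w}"
proof -
  have fin: "finite W" unfolding W using assms(1) by (intro finite_PiE) auto
  have "W \<subseteq> (\<Union>u\<in>{w\<in>W. P w}. (\<lambda>v. u(i := v)) ` V)"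
  proof
    fix w assume w: "w \<in> W"
    then obtain v where v: "v \<in> V" "P (w(i := v))" using good by blast
    have "w(i := v) \<in> W" using w v assms(2) unfolding W by (auto simp: PiE_iff extensional_def)
    moreover have "w = (w(i := v))(i := w i)" by simp
    moreover have "w i \<in> V" using w assms(2) unfolding W by auto
    ultimately show "w \<in> (\<Union>u\<in>{w\<in>W. P w}. (\<lambda>v. u(i := v)) ` V)" using v(2) by blast
  qed
  then have "card W \<le> card (\<Union>u\<in>{w\<in>W. P w}. (\<lambda>v. u(i := v)) ` V)"
    using fin assms(1) by (intro card_mono) auto
  also have "\<dots> \<le> (\<Sum>u\<in>{w\<in>W. P w}. card ((\<lambda>v. u(i := v)) ` V))"
    using fin by (intro card_UN_le) auto
  also have "\<dots> \<le> (\<Sum>u\<in>{w\<in>W. P w}. card V)"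
    using assms(1) by (intro sum_mono card_image_le)
  finally show ?thesis by (simp add: mult.commute)
qed

text \<open>The double counting replaces the letters \<open>x\<close> of a word at three good positions by \<open>y\<close>; the
  resulting base word and the three positions determine the original word, so some base word
  admits a positive proportion of all triples.\<close>

theorem dense_good_triples:
  fixes V :: "'a set" and \<Theta> :: "'t set" and x y :: "'t \<Rightarrow> 'a" and t :: nat
  assumes "finite V" "V \<noteq> {}" "finite \<Theta>" "\<And>\<tau>. \<tau> \<in> \<Theta> \<Longrightarrow> x \<tau> \<in> V \<and> y \<tau> \<in> V"
  obtains M :: nat where "\<forall>m\<ge>M. \<forall>W Good. W = Pi\<^sub>E {..<m} (\<lambda>_. V) \<longrightarrow>
    (\<forall>w\<in>W. \<forall>i<m. \<exists>\<tau>\<in>\<Theta>. Good \<tau> (w(i := x \<tau>)) i) \<longrightarrow>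
    (\<exists>\<tau>\<in>\<Theta>. \<exists>b\<in>W. \<exists>A B C. A \<subseteq> {..<m} \<and> B \<subseteq> {..<m} \<and> C \<subseteq> {..<m} \<and>
      card A = t \<and> card B = t \<and> card C = t \<and>
      (\<forall>i\<in>A. \<forall>j\<in>B. \<forall>k\<in>C. b i = y \<tau> \<and> b j = y \<tau> \<and> b k = y \<tau> \<and>
        (\<forall>e\<in>{i, j, k}. Good \<tau> (\<lambda>u. if u \<in> {i, j, k} then x \<tau> else b u) e)))"
proof (cases "\<Theta> = {}")
  case True
  \<comment> \<open>For m \<ge> 1 the hypothesis on \<open>Good\<close> fails: a word and a position
    exist, but no type does.\<close>
  show ?thesis
  proof (rule that[of 1], intro allI impI)
    fix m :: nat and W and Good :: "'t \<Rightarrow> (nat \<Rightarrow> 'a) \<Rightarrow> nat \<Rightarrow> bool"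
    assume m: "m \<ge> 1" and W: "W = Pi\<^sub>E {..<m} (\<lambda>_. V)"
      and "\<forall>w\<in>W. \<forall>i<m. \<exists>\<tau>\<in>\<Theta>. Good \<tau> (w(i := x \<tau>)) i"
    moreover have "W \<noteq> {}" unfolding W using assms(2) by (simp add: PiE_eq_empty_iff)
    ultimately show "\<exists>\<tau>\<in>\<Theta>. \<exists>b\<in>W. \<exists>A B C. A \<subseteq> {..<m} \<and> B \<subseteq> {..<m} \<and> C \<subseteq> {..<m} \<and>
      card A = t \<and> card B = t \<and> card C = t \<and>
      (\<forall>i\<in>A. \<forall>j\<in>B. \<forall>k\<in>C. b i = y \<tau> \<and> b j = y \<tau> \<and> b k = y \<tau> \<and>
        (\<forall>e\<in>{i, j, k}. Good \<tau> (\<lambda>u. if u \<in> {i, j, k} then x \<tau> else b u) e))"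
      using True by (metis ex_in_conv less_le_trans zero_less_one)
  qed
next
  case False
  \<comment> \<open>For a suitable type a share \<beta> of all pairs of a word and a position is
    good. Then a share \<beta>/2 of the words has at least \<beta> m/2 good positions, hence at
    least (\<beta> m/2)^3 good triples each. The product of the two shares is \<gamma>.\<close>
  define \<beta> where "\<beta> = 1 / (real (card V) * card \<Theta>)"
  have V: "card V > 0" and T: "card \<Theta> > 0" using assms False by (simp_all add: card_gt_0_iff)
  then have \<beta>: "\<beta> > 0" by (simp add: \<beta>_def)
  define \<gamma> where "\<gamma> = \<beta> / 2 * (\<beta> / 2) ^ 3"
  have \<gamma>: "\<gamma> > 0" using \<beta> by (simp add: \<gamma>_def)
  obtain M :: nat where M: "\<forall>m\<ge>M. \<forall>R. \<gamma> * real m ^ 3 \<le> card {(i, j, k). i < m \<and> j < m \<and> k < m \<and> R i j k} \<longrightarrow>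
    (\<exists>A B C. A \<subseteq> {..<m} \<and> B \<subseteq> {..<m} \<and> C \<subseteq> {..<m} \<and> card A = t \<and> card B = t \<and> card C = t \<and>
      (\<forall>i\<in>A. \<forall>j\<in>B. \<forall>k\<in>C. R i j k))"
    using dense_triple_relation_complete[OF \<gamma>, of t] by (rule exE)
  show ?thesis
  \<comment> \<open>\<open>Suc M\<close> also makes m positive, which the cancellation of m below
    requires.\<close>
  proof (rule that[of "Suc M"], intro allI impI)
    fix m :: nat and W and Good :: "'t \<Rightarrow> (nat \<Rightarrow> 'a) \<Rightarrow> nat \<Rightarrow> bool"
    assume m: "m \<ge> Suc M" and W: "W = Pi\<^sub>E {..<m} (\<lambda>_. V)"
      and good: "\<forall>w\<in>W. \<forall>i<m. \<exists>\<tau>\<in>\<Theta>. Good \<tau> (w(i := x \<tau>)) i"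
    have fin: "finite W" unfolding W using assms(1) by (intro finite_PiE) auto
    have ne: "W \<noteq> {}" unfolding W using assms(2) by (simp add: PiE_eq_empty_iff)
    define H where "H = (\<lambda>\<tau> i. {w\<in>W. w i = x \<tau> \<and> Good \<tau> w i})"
    have H: "card W \<le> card V * (\<Sum>\<tau>\<in>\<Theta>. card (H \<tau> i))" if i: "i < m" for i
    proof -
      have "card W \<le> card V * card {w\<in>W. \<exists>\<tau>\<in>\<Theta>. w i = x \<tau> \<and> Good \<tau> w i}"
      proof (rule card_words_le_good_words[OF assms(1) i W])
        fix w assume "w \<in> W"
        then obtain \<tau> where "\<tau> \<in> \<Theta>" "Good \<tau> (w(i := x \<tau>)) i" using good i by blast
        then show "\<exists>v\<in>V. \<exists>\<tau>\<in>\<Theta>. (w(i := v)) i = x \<tau> \<and> Good \<tau> (w(i := v)) i"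
          using assms(4) by (intro bexI[of _ "x \<tau>"] bexI[of _ \<tau>]) auto
      qed
      also have "{w\<in>W. \<exists>\<tau>\<in>\<Theta>. w i = x \<tau> \<and> Good \<tau> w i} = (\<Union>\<tau>\<in>\<Theta>. H \<tau> i)" by (auto simp: H_def)
      also have "card V * card (\<Union>\<tau>\<in>\<Theta>. H \<tau> i) \<le> card V * (\<Sum>\<tau>\<in>\<Theta>. card (H \<tau> i))"
        using assms(3) by (intro mult_left_mono card_UN_le) auto
      finally show ?thesis .
    qed
    have "m * card W = (\<Sum>i<m. card W)" by simp
    also have "\<dots> \<le> (\<Sum>i<m. card V * (\<Sum>\<tau>\<in>\<Theta>. card (H \<tau> i)))" using H by (intro sum_mono) auto
    also have "\<dots> = card V * (\<Sum>\<tau>\<in>\<Theta>. \<Sum>i<m. card (H \<tau> i))"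
      by (subst sum.swap) (simp add: sum_distrib_left)
    finally have "real (m * card W) \<le> real (card V * (\<Sum>\<tau>\<in>\<Theta>. \<Sum>i<m. card (H \<tau> i)))"
      by (rule of_nat_mono)
    then have "\<beta> * m * card W * card \<Theta> \<le> (\<Sum>\<tau>\<in>\<Theta>. real (\<Sum>i<m. card (H \<tau> i)))"
      using V T by (simp add: \<beta>_def field_simps)
    from exists_ge_average[OF assms(3) False this]
    obtain \<tau> where \<tau>: "\<tau> \<in> \<Theta>" "\<beta> * m * card W \<le> real (\<Sum>i<m. card (H \<tau> i))" by blast
    define D where "D = (\<lambda>w. {i\<in>{..<m}. w i = x \<tau> \<and> Good \<tau> w i})"
    have "(\<Sum>w\<in>W. card (D w)) = (\<Sum>i<m. card (H \<tau> i))"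
      unfolding D_def H_def by (rule sum_card_swap) (use fin in auto)
    then have avg: "\<beta> * m * card W \<le> (\<Sum>w\<in>W. real (card (D w)))" using \<tau>(2) by (simp flip: of_nat_sum)
    have "\<beta> * m / 2 * card W \<le> real m * card {w\<in>W. \<beta> * m / 2 \<le> card (D w)}"
    proof (rule card_large_values[OF fin _ _ avg])
      show "real (card (D w)) \<le> real m" for w
        using card_mono[of "{..<m}" "D w"] by (auto simp: D_def)
    qed (use \<beta> in auto)
    then have large: "\<beta> / 2 * card W \<le> card {w\<in>W. \<beta> * m / 2 \<le> card (D w)}"
      using m by (simp add: field_simps)
    define up where "up = (\<lambda>(w :: nat \<Rightarrow> 'a) (i, j, k) v u. if u \<in> {i, j, k} then v else w u)"
    define R where "R = (\<lambda>b i j k. b i = y \<tau> \<and> b j = y \<tau> \<and> b k = y \<tau> \<and>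
      {i, j, k} \<subseteq> D (up b (i, j, k) (x \<tau>)))"
    define TR where "TR = (\<lambda>b. {(i, j, k). i < m \<and> j < m \<and> k < m \<and> R b i j k})"
    \<comment> \<open>Triples may repeat a position, so their number is exactly the cube of
      \<open>card (D w)\<close>.\<close>
    define S where "S = (SIGMA w:W. D w \<times> D w \<times> D w)"
    have finT: "finite (TR b)" for b
      by (rule finite_subset[of _ "{..<m} \<times> {..<m} \<times> {..<m}"]) (auto simp: TR_def)
    have restore: "up (up w I (y \<tau>)) I (x \<tau>) = w" if "(w, I) \<in> S" for w I
      using that by (auto simp: S_def up_def D_def fun_eq_iff)
    have "inj_on (\<lambda>(w, I). (up w I (y \<tau>), I)) S"
      by (rule inj_on_inverseI[where g = "\<lambda>(b, I). (up b I (x \<tau>), I)"]) (use restore in auto)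
    moreover have "(\<lambda>(w, I). (up w I (y \<tau>), I)) ` S \<subseteq> (SIGMA b:W. TR b)"
    proof (rule image_subsetI)
      fix p assume "p \<in> S"
      then obtain w i j k where p: "p = (w, i, j, k)" and S: "(w, i, j, k) \<in> S" by (cases p) auto
      then have "i < m" "j < m" "k < m" "{i, j, k} \<subseteq> D w" "w \<in> W" by (auto simp: S_def D_def)
      moreover from this have "up w (i, j, k) (y \<tau>) \<in> W"
        using assms(4)[OF \<tau>(1)] unfolding W up_def by (auto simp: PiE_iff extensional_def)
      moreover have "up w (i, j, k) (y \<tau>) u = y \<tau>" if "u \<in> {i, j, k}" for u
        using that by (simp add: up_def)
      ultimately show "(case p of (w, I) \<Rightarrow> (up w I (y \<tau>), I)) \<in> (SIGMA b:W. TR b)"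
        using restore[OF S] by (simp add: TR_def R_def p)
    qed
    ultimately have "card S \<le> card (SIGMA b:W. TR b)"
      using fin finT by (intro card_inj_on_le) auto
    also have "card S = (\<Sum>w\<in>W. card (D w) ^ 3)"
      unfolding S_def using fin by (subst card_SigmaI) (auto simp: D_def card_cartesian_product power3_eq_cube mult.assoc)
    also have "card (SIGMA b:W. TR b) = (\<Sum>b\<in>W. card (TR b))"
      using fin finT by (intro card_SigmaI) auto
    finally have "real (\<Sum>w\<in>W. card (D w) ^ 3) \<le> real (\<Sum>b\<in>W. card (TR b))" by (rule of_nat_mono)
    then have le: "(\<Sum>w\<in>W. real (card (D w)) ^ 3) \<le> (\<Sum>b\<in>W. real (card (TR b)))" by simp
    have "\<gamma> * real m ^ 3 * card W = \<beta> / 2 * card W * (\<beta> * m / 2) ^ 3"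
      by (simp add: \<gamma>_def power_mult_distrib power_divide)
    also have "\<dots> \<le> card {w\<in>W. \<beta> * m / 2 \<le> card (D w)} * (\<beta> * m / 2) ^ 3"
      using large \<beta> by (intro mult_right_mono) auto
    also have "\<dots> = (\<Sum>w | w \<in> W \<and> \<beta> * m / 2 \<le> card (D w). (\<beta> * m / 2) ^ 3)" by simp
    also have "\<dots> \<le> (\<Sum>w | w \<in> W \<and> \<beta> * m / 2 \<le> card (D w). real (card (D w)) ^ 3)"
      using \<beta> by (intro sum_mono power_mono) auto
    also have "\<dots> \<le> (\<Sum>w\<in>W. real (card (D w)) ^ 3)"
      using fin by (intro sum_mono2) auto
    also note le
    finally have "\<exists>b\<in>W. \<gamma> * real m ^ 3 \<le> real (card (TR b))" by (rule exists_ge_average[OF fin ne])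
    then obtain b where b: "b \<in> W" "\<gamma> * real m ^ 3 \<le> real (card (TR b))" by blast
    have "M \<le> m" using m by simp
    from M[rule_format, OF this b(2)[unfolded TR_def]]
    obtain A B C where ABC: "A \<subseteq> {..<m}" "B \<subseteq> {..<m}" "C \<subseteq> {..<m}" "card A = t" "card B = t" "card C = t"
      and R: "\<forall>i\<in>A. \<forall>j\<in>B. \<forall>k\<in>C. R b i j k" by (elim exE conjE)
    have "b i = y \<tau> \<and> b j = y \<tau> \<and> b k = y \<tau> \<and>
        (\<forall>e\<in>{i, j, k}. Good \<tau> (\<lambda>u. if u \<in> {i, j, k} then x \<tau> else b u) e)"
      if "i \<in> A" "j \<in> B" "k \<in> C" for i j k
    proof -
      have "R b i j k" using R that by blast
      then show ?thesis unfolding R_def D_def up_def by auto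
    qed
    then have good3: "\<forall>i\<in>A. \<forall>j\<in>B. \<forall>k\<in>C. b i = y \<tau> \<and> b j = y \<tau> \<and> b k = y \<tau> \<and>
        (\<forall>e\<in>{i, j, k}. Good \<tau> (\<lambda>u. if u \<in> {i, j, k} then x \<tau> else b u) e)" by blast
    show "\<exists>\<tau>\<in>\<Theta>. \<exists>b\<in>W. \<exists>A B C. A \<subseteq> {..<m} \<and> B \<subseteq> {..<m} \<and> C \<subseteq> {..<m} \<and>
      card A = t \<and> card B = t \<and> card C = t \<and>
      (\<forall>i\<in>A. \<forall>j\<in>B. \<forall>k\<in>C. b i = y \<tau> \<and> b j = y \<tau> \<and> b k = y \<tau> \<and>
        (\<forall>e\<in>{i, j, k}. Good \<tau> (\<lambda>u. if u \<in> {i, j, k} then x \<tau> else b u) e))"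
      by (rule bexI[OF _ \<tau>(1)], rule bexI[OF _ b(1)], intro exI conjI) (rule ABC good3)+
  qed
qed

section \<open>Cycles of points and lines in a grid\<close>

text \<open>The tag 0, 1 or 2 names the axis. Deleting an element leaves the line in that direction,
  and incidence of points and lines becomes inclusion of sets.\<close>

definition tri :: "nat \<Rightarrow> nat \<Rightarrow> nat \<Rightarrow> (nat \<times> nat) set" where
  "tri i j k = {(0, i), (1, j), (2, k)}"

text \<open>A cyclic sequence of points \<open>P\<close> of a three-dimensional grid, encoded as transversals, together with
  the axis-parallel lines \<open>L\<close> joining consecutive points, encoded by dropping the free coordinate.
  Each line passes through no further point of the sequence.\<close>

definition incidence_cycle :: "nat \<Rightarrow> (nat \<Rightarrow> (nat \<times> nat) set) \<Rightarrow> (nat \<Rightarrow> (nat \<times> nat) set) \<Rightarrow> bool" where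
  "incidence_cycle l P L \<longleftrightarrow>
    (\<forall>s<l. \<exists>i j k. i < l \<and> j < l \<and> k < l \<and> P s = tri i j k) \<and>
    (\<forall>s<l. \<exists>e. e \<notin> L s \<and> P s = insert e (L s)) \<and>
    (\<forall>s<l. \<exists>e. e \<notin> L s \<and> P (Suc s mod l) = insert e (L s)) \<and>
    (\<forall>s<l. \<forall>j<l. L s \<subseteq> P j \<longrightarrow> j = s \<or> j = Suc s mod l)"

text \<open>The staircase (u, u, 0), (u + 1, u, 0) with first coordinate modulo p closes up in a
  plane. For p = 1 its points would coincide.\<close>

lemma incidence_cycle_even:
  assumes "p \<ge> 2"
  shows "\<exists>P L. incidence_cycle (2 * p) P L"
proof -
  define P where "P = (\<lambda>s. tri ((s + 1) div 2 mod p) (s div 2) 0)"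
  define L where "L = (\<lambda>s. if even s then {(1, s div 2), (2, 0)} else {(0, (s + 1) div 2 mod p), (2::nat, 0::nat)})"
  have next_odd: "Suc (2 * u + 1) mod (2 * p) = 2 * ((u + 1) mod p)" for u
    using mult_mod_right[of 2 "u + 1" p] by simp
  have "incidence_cycle (2 * p) P L"
    unfolding incidence_cycle_def
  proof (intro conjI allI impI)
    fix s assume s: "s < 2 * p"
    have "(s + 1) div 2 mod p < p" using assms by (intro mod_less_divisor) simp
    then have "(s + 1) div 2 mod p < 2 * p" "s div 2 < 2 * p" "0 < 2 * p" using s assms by linarith+
    then show "\<exists>i j k. i < 2 * p \<and> j < 2 * p \<and> k < 2 * p \<and> P s = tri i j k"
      unfolding P_def by blast
    show "\<exists>e. e \<notin> L s \<and> P s = insert e (L s)"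
      by (cases "even s"; intro exI[of _ "if even s then (0, (s + 1) div 2 mod p) else (1, s div 2)"])
        (auto simp: P_def L_def tri_def)
    show "\<exists>e. e \<notin> L s \<and> P (Suc s mod (2 * p)) = insert e (L s)"
    proof (cases "even s")
      case True
      then obtain u where u: "s = 2 * u" by blast
      with s have "Suc s mod (2 * p) = 2 * u + 1" by simp
      then show ?thesis using u
        by (intro exI[of _ "(0, (u + 1) mod p)"]) (auto simp: P_def L_def tri_def)
    next
      case False
      then obtain u where u: "s = 2 * u + 1" by (rule oddE)
      show ?thesis unfolding u next_odd
        by (intro exI[of _ "(1, (u + 1) mod p)"]) (auto simp: P_def L_def tri_def)
    qed
    fix j assume j: "j < 2 * p" and sub: "L s \<subseteq> P j"
    show "j = s \<or> j = Suc s mod (2 * p)"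
    proof (cases "even s")
      case True
      with sub have "s div 2 = j div 2" by (auto simp: P_def L_def tri_def)
      moreover have "Suc s < 2 * p" using True s by presburger
      ultimately show ?thesis using True by simp presburger
    next
      case False
      then obtain u where u: "s = 2 * u + 1" by (rule oddE)
      with sub have eq: "(u + 1) mod p = (j + 1) div 2 mod p" by (auto simp: P_def L_def tri_def)
      show ?thesis
      proof (cases "even j")
        case True
        then obtain v where v: "j = 2 * v" by blast
        with eq j have "(u + 1) mod p = v" by simp
        then show ?thesis unfolding u next_odd v by simp
      next
        case False
        then obtain v where v: "j = 2 * v + 1" by (rule oddE)
        have uv: "u < p" "v < p" using s j u v by auto
        have "(u + 1) mod p = (v + 1) mod p" using eq v by simp
        then have "u = v" using uv by (cases "u + 1 = p"; cases "v + 1 = p") auto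
        then show ?thesis using u v by simp
      qed
    qed
  qed
  then show ?thesis by blast
qed

text \<open>The cycle is a staircase in level \<open>0\<close> closed up through three points in level \<open>1\<close>.\<close>

lemma incidence_cycle_odd:
  assumes "q \<ge> 2"
  shows "\<exists>P L. incidence_cycle (2 * q + 3) P L"
proof -
  \<comment> \<open>The staircase runs from (0, 0, 0) to (q, q - 1, 0) in 2 q points; then follow
    (q, q - 1, 1), (0, q - 1, 1) and (0, 0, 1). The last two are distinct because q \<ge> 2.\<close>
  define P where "P = (\<lambda>s. if s < 2 * q then tri ((s + 1) div 2) (s div 2) 0
    else if s = 2 * q then tri q (q - 1) 1 else if s = 2 * q + 1 then tri 0 (q - 1) 1 else tri 0 0 1)"
  define L where "L = (\<lambda>s::nat. if s = 2 * q - 1 then {(0::nat, q), (1, q - 1)}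
    else if s < 2 * q \<and> even s then {(1, s div 2), (2, 0)}
    else if s < 2 * q then {(0, (s + 1) div 2), (2, 0)}
    else if s = 2 * q then {(1, q - 1), (2, 1)}
    else if s = 2 * q + 1 then {(0, 0), (2, 1)} else {(0, 0), (1, 0)})"
  note defs = P_def L_def tri_def
  have split: "s < 2 * q - 1 \<and> even s \<or> s < 2 * q - 1 \<and> odd s \<or> s = 2 * q - 1 \<or> s = 2 * q \<or> s = 2 * q + 1 \<or> s = 2 * q + 2"
    if "s < 2 * q + 3" for s using that by linarith
  have q: "2 * q - 1 < 2 * q" "odd (2 * q - 1)" "(2 * q - 1) div 2 = q - 1" "Suc (2 * q - 1) div 2 = q"
    using assms by presburger+
  have "incidence_cycle (2 * q + 3) P L"
    unfolding incidence_cycle_def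
  proof (intro conjI allI impI)
    fix s assume s: "s < 2 * q + 3"
    have "(s + 1) div 2 < 2 * q + 3" "s div 2 < 2 * q + 3" "q < 2 * q + 3" "q - 1 < 2 * q + 3"
      "0 < 2 * q + 3" "1 < 2 * q + 3" using s by linarith+
    then show "\<exists>i j k. i < 2 * q + 3 \<and> j < 2 * q + 3 \<and> k < 2 * q + 3 \<and> P s = tri i j k"
      unfolding P_def by (metis (full_types))
    from split[OF s] show "\<exists>e. e \<notin> L s \<and> P s = insert e (L s)"
    proof (elim disjE conjE)
      assume "s < 2 * q - 1" "even s"
      then show ?thesis by (intro exI[of _ "(0, (s + 1) div 2)"]) (auto simp: defs)
    next
      assume "s < 2 * q - 1" "odd s"
      then show ?thesis by (intro exI[of _ "(1, s div 2)"]) (auto simp: defs)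
    next
      assume "s = 2 * q - 1"
      then show ?thesis using q by (intro exI[of _ "(2, 0)"]) (auto simp: defs)
    next
      assume "s = 2 * q"
      then show ?thesis using assms by (intro exI[of _ "(0, q)"]) (auto simp: defs)
    next
      assume "s = 2 * q + 1"
      then show ?thesis using assms by (intro exI[of _ "(1, q - 1)"]) (auto simp: defs)
    next
      assume "s = 2 * q + 2"
      then show ?thesis using assms by (intro exI[of _ "(2, 1)"]) (auto simp: defs)
    qed
    from split[OF s] show "\<exists>e. e \<notin> L s \<and> P (Suc s mod (2 * q + 3)) = insert e (L s)"
    proof (elim disjE conjE)
      assume "s < 2 * q - 1" "even s"
      then show ?thesis by (intro exI[of _ "(0, Suc (s div 2))"]) (auto simp: defs)
    next
      assume "s < 2 * q - 1" "odd s"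
      then show ?thesis by (intro exI[of _ "(1, Suc s div 2)"]) (auto simp: defs)
    next
      assume "s = 2 * q - 1"
      then show ?thesis using q assms by (intro exI[of _ "(2, 1)"]) (auto simp: defs)
    next
      assume "s = 2 * q"
      then show ?thesis using assms by (intro exI[of _ "(0, 0)"]) (auto simp: defs)
    next
      assume "s = 2 * q + 1"
      then show ?thesis using assms by (intro exI[of _ "(1, 0)"]) (auto simp: defs)
    next
      assume s: "s = 2 * q + 2"
      then have "Suc s = 2 * q + 3" by simp
      then have "Suc s mod (2 * q + 3) = 0" by (metis mod_self)
      moreover have "P 0 = {(0, 0), (1, 0), (2, 0)}" using assms by (simp add: P_def tri_def)
      moreover have "L s = {(0, 0), (1, 0)}" using s assms by (auto simp: L_def)
      ultimately have "P (Suc s mod (2 * q + 3)) = {(0, 0), (1, 0), (2, 0)}" "L s = {(0, 0), (1, 0)}"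
        by metis+
      then show ?thesis by (intro exI[of _ "(2, 0)"]) auto
    qed
    fix j assume j: "j < 2 * q + 3" and sub: "L s \<subseteq> P j"
    have nxt: "Suc s mod (2 * q + 3) = Suc s" if "s < 2 * q + 2" using that by simp
    have last: "Suc s mod (2 * q + 3) = 0" if "s = 2 * q + 2"
      using that by (metis Suc_eq_plus1 add.assoc mod_self numeral_plus_one semiring_norm(5))
    from split[OF s] show "j = s \<or> j = Suc s mod (2 * q + 3)"
    proof (elim disjE conjE)
      assume h: "s < 2 * q - 1" "even s"
      then have "L s = {(1, s div 2), (2, 0)}" by (auto simp: L_def)
      then have eq: "s div 2 = j div 2" using sub by (auto simp: P_def tri_def split: if_splits)
      have "j = s \<or> j = Suc s" using eq h(2) by presburger
      then show ?thesis using h nxt by auto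
    next
      assume h: "s < 2 * q - 1" "odd s"
      then have "L s = {(0, (s + 1) div 2), (2, 0)}" by (auto simp: L_def)
      then have eq: "(s + 1) div 2 = (j + 1) div 2"
        using sub by (auto simp: P_def tri_def split: if_splits)
      have "j = s \<or> j = Suc s" using eq h(2) by presburger
      then show ?thesis using h nxt by auto
    next
      assume h: "s = 2 * q - 1"
      then have "L s = {(0, q), (1, q - 1)}" by (auto simp: L_def)
      then have "(j + 1) div 2 = q \<and> j div 2 = q - 1 \<or> j = 2 * q"
        using sub assms by (auto simp: P_def tri_def split: if_splits)
      then have "j = s \<or> j = Suc s" using h assms by presburger
      then show ?thesis using h nxt by auto
    next
      assume h: "s = 2 * q"
      then have "L s = {(1, q - 1), (2, 1)}" using assms by (auto simp: L_def)
      then have "j = 2 * q \<or> j = 2 * q + 1"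
        using sub assms by (auto simp: P_def tri_def split: if_splits)
      then show ?thesis using h nxt by auto
    next
      assume h: "s = 2 * q + 1"
      then have "L s = {(0, 0), (2, 1)}" using assms by (auto simp: L_def)
      then have "j = 2 * q + 1 \<or> j \<ge> 2 * q + 2"
        using sub assms by (auto simp: P_def tri_def split: if_splits)
      then show ?thesis using h j nxt by auto
    next
      assume h: "s = 2 * q + 2"
      then have "L s = {(0, 0), (1, 0)}" using assms by (auto simp: L_def)
      then have "(j + 1) div 2 = 0 \<or> j \<ge> 2 * q + 2"
        using sub assms by (auto simp: P_def tri_def split: if_splits)
      then have "j = s \<or> j = 0" using h j by presburger
      then show ?thesis using h last by auto
    qed
  qed
  then show ?thesis by blast
qed

text \<open>There is no such cycle for l = 3 or l = 5: consecutive lines have different directions,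
  and a closed walk uses each of its directions at least twice, so at most two directions occur, and
  these cannot alternate around an odd cycle.\<close>

lemma incidence_cycle_exists:
  assumes "l = 4 \<or> l \<ge> 6"
  shows "\<exists>P L. incidence_cycle l P L"
proof (cases "even l")
  case True
  then obtain p where "l = 2 * p" by blast
  then show ?thesis using assms incidence_cycle_even[of p] by auto
next
  case False
  then have "l = 2 * ((l - 3) div 2) + 3" "(l - 3) div 2 \<ge> 2" using assms by presburger+
  then show ?thesis using incidence_cycle_odd by metis
qed

text \<open>The sets from \<open>dense_good_triples\<close> may overlap, so size 3 t is requested:
  after removal of the at most 2 t positions already taken, t remain for each set. The map g then
  names the chosen positions by grid coordinates.\<close>

lemma good_grid:
  fixes V :: "'a set" and \<Theta> :: "'t set" and x y :: "'t \<Rightarrow> 'a" and t :: nat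
  assumes "finite V" "V \<noteq> {}" "finite \<Theta>" "\<And>\<tau>. \<tau> \<in> \<Theta> \<Longrightarrow> x \<tau> \<in> V \<and> y \<tau> \<in> V" "t > 0"
  obtains m :: nat where "\<forall>W Good. W = Pi\<^sub>E {..<m} (\<lambda>_. V) \<longrightarrow>
    (\<forall>w\<in>W. \<forall>i<m. \<exists>\<tau>\<in>\<Theta>. Good \<tau> (w(i := x \<tau>)) i) \<longrightarrow>
    (\<exists>\<tau>\<in>\<Theta>. \<exists>b\<in>W. \<exists>g. inj_on g ({0, 1, 2} \<times> {..<t}) \<and> g ` ({0, 1, 2} \<times> {..<t}) \<subseteq> {..<m} \<and>
      (\<forall>e\<in>{0, 1, 2} \<times> {..<t}. b (g e) = y \<tau>) \<and>
      (\<forall>i<t. \<forall>j<t. \<forall>k<t. \<forall>e\<in>tri i j k. Good \<tau> (\<lambda>u. if u \<in> g ` tri i j k then x \<tau> else b u) (g e)))"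
proof -
  obtain M :: nat where M: "\<forall>m\<ge>M. \<forall>W Good. W = Pi\<^sub>E {..<m} (\<lambda>_. V) \<longrightarrow>
    (\<forall>w\<in>W. \<forall>i<m. \<exists>\<tau>\<in>\<Theta>. Good \<tau> (w(i := x \<tau>)) i) \<longrightarrow>
    (\<exists>\<tau>\<in>\<Theta>. \<exists>b\<in>W. \<exists>A B C. A \<subseteq> {..<m} \<and> B \<subseteq> {..<m} \<and> C \<subseteq> {..<m} \<and>
      card A = 3 * t \<and> card B = 3 * t \<and> card C = 3 * t \<and>
      (\<forall>i\<in>A. \<forall>j\<in>B. \<forall>k\<in>C. b i = y \<tau> \<and> b j = y \<tau> \<and> b k = y \<tau> \<and>
        (\<forall>e\<in>{i, j, k}. Good \<tau> (\<lambda>u. if u \<in> {i, j, k} then x \<tau> else b u) e)))"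
    by (rule dense_good_triples[OF assms(1-4), where t = "3 * t"])
  show ?thesis
  proof (rule that[of M], intro allI impI)
    fix W and Good :: "'t \<Rightarrow> (nat \<Rightarrow> 'a) \<Rightarrow> nat \<Rightarrow> bool"
    assume "W = Pi\<^sub>E {..<M} (\<lambda>_. V)"
      "\<forall>w\<in>W. \<forall>i<M. \<exists>\<tau>\<in>\<Theta>. Good \<tau> (w(i := x \<tau>)) i"
    from M[THEN spec, THEN mp, OF order_refl, THEN spec, THEN spec, THEN mp, THEN mp, OF this] obtain \<tau> b A B C where \<tau>: "\<tau> \<in> \<Theta>" and b: "b \<in> W"
      and ABC: "A \<subseteq> {..<M}" "B \<subseteq> {..<M}" "C \<subseteq> {..<M}" "card A = 3 * t" "card B = 3 * t" "card C = 3 * t"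
      and good: "\<forall>i\<in>A. \<forall>j\<in>B. \<forall>k\<in>C. b i = y \<tau> \<and> b j = y \<tau> \<and> b k = y \<tau> \<and>
        (\<forall>e\<in>{i, j, k}. Good \<tau> (\<lambda>u. if u \<in> {i, j, k} then x \<tau> else b u) e)"
      by (elim bexE exE conjE)
    have "t \<le> card A" using ABC by simp
    then obtain A' where A': "A' \<subseteq> A" "card A' = t" "finite A'" by (rule obtain_subset_with_card_n)
    have "t \<le> card (B - A')" using diff_card_le_card_Diff[of A' B] A' ABC by simp
    then obtain B' where B': "B' \<subseteq> B - A'" "card B' = t" "finite B'" by (rule obtain_subset_with_card_n)
    have "card (A' \<union> B') \<le> 2 * t" using card_Un_le[of A' B'] A' B' by simp
    then have "t \<le> card (C - (A' \<union> B'))" using diff_card_le_card_Diff[of "A' \<union> B'" C] A' B' ABC by simp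
    then obtain C' where C': "C' \<subseteq> C - (A' \<union> B')" "card C' = t" "finite C'"
      by (rule obtain_subset_with_card_n)
    obtain a b' c where bij: "bij_betw a {..<t} A'" "bij_betw b' {..<t} B'" "bij_betw c {..<t} C'"
      using ex_bij_betw_nat_finite A' B' C' by (metis lessThan_atLeast0)
    define g where "g = (\<lambda>(d::nat, s). if d = 0 then a s else if d = 1 then b' s else c s)"
    have mem: "a s \<in> A'" "b' s \<in> B'" "c s \<in> C'" if "s < t" for s
      using that bij by (auto simp: bij_betw_def)
    have inj: "inj_on g ({0, 1, 2} \<times> {..<t})"
    proof (rule inj_onI)
      fix p p' assume p: "p \<in> {0, 1, 2} \<times> {..<t}" "p' \<in> {0, 1, 2} \<times> {..<t}" "g p = g p'"
      obtain d s d' s' where ds: "p = (d, s)" "p' = (d', s')" by (metis surj_pair)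
      have s: "s < t" "s' < t" and d: "d \<in> {0, 1, 2}" "d' \<in> {0, 1, 2}" using p ds by auto
      have ne: "a u \<noteq> b' v" "a u \<noteq> c v" "b' u \<noteq> c v" if "u < t" "v < t" for u v
        using mem[OF that(1)] mem[OF that(2)] B'(1) C'(1) by auto
      have inj: "a s = a s' \<Longrightarrow> s = s'" "b' s = b' s' \<Longrightarrow> s = s'" "c s = c s' \<Longrightarrow> s = s'"
        using bij s by (auto simp: bij_betw_def inj_on_def)
      show "p = p'"
        using d p(3) ne[OF s] ne[OF s(2) s(1)] inj unfolding ds g_def by (auto split: if_splits)
    qed
    have "g ` ({0, 1, 2} \<times> {..<t}) \<subseteq> A' \<union> B' \<union> C'" using mem by (auto simp: g_def)
    then have sub: "g ` ({0, 1, 2} \<times> {..<t}) \<subseteq> {..<M}" using A' B' C' ABC by blast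
    have tri: "g ` tri i j k = {a i, b' j, c k}" for i j k by (simp add: tri_def g_def)
    have mem': "a s \<in> A" "b' s \<in> B" "c s \<in> C" if "s < t" for s
      using mem[OF that] A' B' C' by auto
    have "b (a s) = y \<tau> \<and> b (b' s) = y \<tau> \<and> b (c s) = y \<tau>" if "s < t" for s
      using good[THEN bspec, THEN bspec, THEN bspec, OF mem'[OF that]] by simp
    then have letters: "\<forall>e\<in>{0, 1, 2} \<times> {..<t}. b (g e) = y \<tau>" by (auto simp: g_def)
    have good': "\<forall>i<t. \<forall>j<t. \<forall>k<t. \<forall>e\<in>tri i j k.
      Good \<tau> (\<lambda>u. if u \<in> g ` tri i j k then x \<tau> else b u) (g e)"
    proof (intro allI impI ballI)
      fix i j k e assume "i < t" "j < t" "k < t" "e \<in> tri i j k"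
      then have "g e \<in> {a i, b' j, c k}" using tri[of i j k] by blast
      then show "Good \<tau> (\<lambda>u. if u \<in> g ` tri i j k then x \<tau> else b u) (g e)"
        unfolding tri using good[THEN bspec, THEN bspec, THEN bspec,
            OF mem'(1)[OF \<open>i < t\<close>] mem'(2)[OF \<open>j < t\<close>] mem'(3)[OF \<open>k < t\<close>]] by (elim conjE bspec)
    qed
    show "\<exists>\<tau>\<in>\<Theta>. \<exists>b\<in>W. \<exists>g. inj_on g ({0, 1, 2} \<times> {..<t}) \<and> g ` ({0, 1, 2} \<times> {..<t}) \<subseteq> {..<M} \<and>
      (\<forall>e\<in>{0, 1, 2} \<times> {..<t}. b (g e) = y \<tau>) \<and>
      (\<forall>i<t. \<forall>j<t. \<forall>k<t. \<forall>e\<in>tri i j k. Good \<tau> (\<lambda>u. if u \<in> g ` tri i j k then x \<tau> else b u) (g e))"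
      by (rule bexI[OF _ \<tau>], rule bexI[OF _ b], intro exI conjI) (rule inj sub letters good')+
  qed
qed

lemma Suc_mod_asym:
  assumes "s < l" "s' < l" "l \<ge> 3" "s' = Suc s mod l" shows "s \<noteq> Suc s' mod l"
proof (cases "Suc s = l")
  case True
  then have "s' = 0" using assms by simp
  then show ?thesis using True assms(3) by auto
next
  case False
  then have s': "s' = Suc s" using assms by simp
  then show ?thesis using assms by (cases "Suc s' = l") auto
qed

text \<open>These 2 l sets become the vertices of the graph cycle. Neighbours differ by a single
  element, hence their words by a single letter.\<close>

definition cycle_sets :: "(nat \<Rightarrow> 'a set) \<Rightarrow> (nat \<Rightarrow> 'a set) \<Rightarrow> nat \<Rightarrow> 'a set" where
  "cycle_sets P L k = (if even k then P (k div 2) else L (k div 2))"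

text \<open>Colors are controlled only when one letter of the word of a full transversal is changed,
  so it matters which of two neighbours is the transversal. The parity tells this also at the
  wrap-around.\<close>

lemma cycle_sets_step:
  assumes cyc: "incidence_cycle l P L" and k: "k < 2 * l"
  obtains i j h e where "i < l" "j < l" "h < l" "e \<in> tri i j h"
    "cycle_sets P L k = tri i j h \<and> cycle_sets P L (Suc k mod (2 * l)) = tri i j h - {e} \<and> even k \<or>
     cycle_sets P L k = tri i j h - {e} \<and> cycle_sets P L (Suc k mod (2 * l)) = tri i j h \<and> odd k"
proof (cases "even k")
  case True
  then obtain s where s: "k = 2 * s" by blast
  have sl: "s < l" using s k by simp
  have "Suc k < 2 * l" using True k by presburger
  then have eq: "cycle_sets P L (Suc k mod (2 * l)) = L s" "cycle_sets P L k = P s"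
    using s by (simp_all add: cycle_sets_def)
  obtain i j h where "i < l" "j < l" "h < l" "P s = tri i j h"
    using cyc sl unfolding incidence_cycle_def by blast
  moreover obtain e where "e \<notin> L s" "P s = insert e (L s)" using cyc sl unfolding incidence_cycle_def by blast
  ultimately show ?thesis using that[of i j h e] eq True by (metis Diff_insert_absorb insertI1)
next
  case False
  then obtain s where s: "k = 2 * s + 1" by (rule oddE)
  have sl: "s < l" using s k by simp
  have "Suc k mod (2 * l) = 2 * (Suc s mod l)" using s mult_mod_right[of 2 "Suc s" l] by simp
  then have eq: "cycle_sets P L (Suc k mod (2 * l)) = P (Suc s mod l)" "cycle_sets P L k = L s"
    using s by (simp_all add: cycle_sets_def)
  have "Suc s mod l < l" using sl by simp
  then obtain i j h where "i < l" "j < l" "h < l" "P (Suc s mod l) = tri i j h"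
    using cyc unfolding incidence_cycle_def by blast
  moreover obtain e where "e \<notin> L s" "P (Suc s mod l) = insert e (L s)"
    using cyc sl unfolding incidence_cycle_def by blast
  ultimately show ?thesis using that[of i j h e] eq False by (metis Diff_insert_absorb insertI1)
qed

lemma symmetric_difference_two:
  assumes "finite A" "finite B" "A \<noteq> B" "card A = card B \<or> (card A \<le> card B \<and> \<not> A \<subseteq> B)"
  shows "\<exists>a b. a \<noteq> b \<and> a \<in> A - B \<and> b \<in> B - A"
proof -
  have "\<not> A \<subseteq> B" using assms card_subset_eq by blast
  moreover have "\<not> B \<subseteq> A" using assms card_subset_eq by (metis card_mono le_antisym)
  ultimately obtain a b where "a \<in> A - B" "b \<in> B - A" by blast
  moreover from this have "a \<noteq> b" by auto
  ultimately show ?thesis by blast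
qed

text \<open>Non-neighbours are incomparable sets, so their words will differ in at least two
  letters. Points have three elements and lines two; a line is contained only in the two points next
  to it, which settles the mixed case and makes points, as well as lines, pairwise distinct.\<close>

lemma cycle_sets_far:
  assumes cyc: "incidence_cycle l P L" and l: "l \<ge> 3" and uv: "u < 2 * l" "v < 2 * l" "u \<noteq> v"
    and nonadj: "v \<noteq> Suc u mod (2 * l)" "u \<noteq> Suc v mod (2 * l)"
  shows "\<exists>a b. a \<noteq> b \<and> a \<in> cycle_sets P L u - cycle_sets P L v \<and> b \<in> cycle_sets P L v - cycle_sets P L u"
proof -
  have inc: "j = s \<or> j = Suc s mod l" if "s < l" "j < l" "L s \<subseteq> P j" for s j
    using cyc that unfolding incidence_cycle_def by blast
  have LP: "L s \<subseteq> P s" "card (L s) = 2" "finite (L s)" "card (P s) = 3" "finite (P s)" if "s < l" for s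
  proof -
    obtain i j k where "P s = tri i j k" using cyc \<open>s < l\<close> unfolding incidence_cycle_def by blast
    then show P: "card (P s) = 3" "finite (P s)" by (simp_all add: tri_def)
    obtain e where e: "e \<notin> L s" "P s = insert e (L s)"
      using cyc \<open>s < l\<close> unfolding incidence_cycle_def by blast
    show "finite (L s)" using P e by simp
    then show "L s \<subseteq> P s" "card (L s) = 2" using P e by auto
  qed
  have neq: "P s \<noteq> P s'" "L s \<noteq> L s'" if "s < l" "s' < l" "s \<noteq> s'" for s s'
    using inc[of s s'] inc[of s' s] LP(1)[of s] LP(1)[of s'] that Suc_mod_asym[of s l s'] l by auto
  have mixed: "\<exists>a b. a \<noteq> b \<and> a \<in> L s - P j \<and> b \<in> P j - L s"
    if sj: "s < l" "j < l" and na: "2 * j \<noteq> Suc (2 * s + 1) mod (2 * l)" "2 * s + 1 \<noteq> Suc (2 * j) mod (2 * l)" for s j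
  proof -
    have "Suc (2 * s + 1) mod (2 * l) = 2 * (Suc s mod l)" using mult_mod_right[of 2 "Suc s" l] by simp
    then have "j \<noteq> Suc s mod l" using na by auto
    moreover have "j \<noteq> s" using na(2) sj by auto
    ultimately have "\<not> L s \<subseteq> P j" using inc sj by blast
    then show ?thesis using LP[OF sj(1)] LP[OF sj(2)] by (intro symmetric_difference_two) auto
  qed
  show ?thesis
  proof (cases "even u"; cases "even v")
    assume "even u" "even v"
    then obtain s s' where s: "u = 2 * s" "v = 2 * s'" by blast
    then have l: "s < l" "s' < l" and "s \<noteq> s'" using uv by auto
    then have "\<exists>a b. a \<noteq> b \<and> a \<in> P s - P s' \<and> b \<in> P s' - P s"
      using LP(4)[OF l(1)] LP(4)[OF l(2)] neq(1)[OF l]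
      by (intro symmetric_difference_two LP(5)) auto
    then show ?thesis using s by (simp add: cycle_sets_def)
  next
    assume "odd u" "odd v"
    then obtain s s' where s: "u = 2 * s + 1" "v = 2 * s' + 1" by (elim oddE)
    then have l: "s < l" "s' < l" and "s \<noteq> s'" using uv by auto
    then have "\<exists>a b. a \<noteq> b \<and> a \<in> L s - L s' \<and> b \<in> L s' - L s"
      using LP(2)[OF l(1)] LP(2)[OF l(2)] neq(2)[OF l]
      by (intro symmetric_difference_two LP(3)) auto
    then show ?thesis using s by (simp add: cycle_sets_def)
  next
    assume "odd u" "even v"
    then obtain s j where "u = 2 * s + 1" "v = 2 * j" by (elim oddE evenE)
    then show ?thesis using mixed[of s j] uv nonadj by (simp add: cycle_sets_def)
  next
    assume "even u" "odd v"
    then obtain s j where "v = 2 * s + 1" "u = 2 * j" by (elim oddE evenE)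
    then have "\<exists>a b. a \<noteq> b \<and> a \<in> cycle_sets P L v - cycle_sets P L u \<and> b \<in> cycle_sets P L u - cycle_sets P L v"
      using mixed[of s j] uv nonadj by (simp add: cycle_sets_def)
    then show ?thesis by metis
  qed
qed

section \<open>Words as points of space\<close>

lemma cycle_graph_edge_iff:
  assumes "u < k" "v < k"
  shows "{u, v} \<in> edges (cycle_graph k) \<longleftrightarrow> v = Suc u mod k \<or> u = Suc v mod k"
proof -
  have "{u, v} \<in> edges (cycle_graph k) \<longleftrightarrow> (\<exists>i<k. {u, v} = {i, Suc i mod k})"
    unfolding cycle_graph_def by simp blast
  also have "\<dots> \<longleftrightarrow> (\<exists>i<k. u = i \<and> v = Suc i mod k \<or> u = Suc i mod k \<and> v = i)"
    by (simp only: doubleton_eq_iff)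
  also have "\<dots> \<longleftrightarrow> v = Suc u mod k \<or> u = Suc v mod k" using assms by blast
  finally show ?thesis .
qed

lemma unit_copy_cycle_graph:
  assumes "inj_on F {..<k}" "\<And>u. u < k \<Longrightarrow> norm (F u - F (Suc u mod k)) = 1"
  shows "unit_copy (cycle_graph k) (F ` {..<k})"
  unfolding unit_copy_def
proof (intro exI conjI ballI impI)
  show "bij_betw F (verts (cycle_graph k)) (F ` {..<k})"
    using assms(1) by (simp add: bij_betw_def cycle_graph_def)
  fix u v assume uv: "u \<in> verts (cycle_graph k)" "v \<in> verts (cycle_graph k)"
    and e: "{u, v} \<in> edges (cycle_graph k)"
  have k: "u < k" "v < k" using uv by (simp_all add: cycle_graph_def)
  from e have "v = Suc u mod k \<or> u = Suc v mod k" by (simp add: cycle_graph_edge_iff[OF k])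
  then show "norm (F u - F v) = 1" using assms(2) k by (metis norm_minus_commute)
qed

text \<open>Excluding distance 0 for non-neighbours yields injectivity as well, since neighbours are
  at distance 1.\<close>

lemma induced_unit_copy_cycle_graph:
  assumes step: "\<And>u. u < k \<Longrightarrow> norm (F u - F (Suc u mod k)) = 1"
    and far: "\<And>u v. u < k \<Longrightarrow> v < k \<Longrightarrow> u \<noteq> v \<Longrightarrow> v \<noteq> Suc u mod k \<Longrightarrow> u \<noteq> Suc v mod k \<Longrightarrow>
      norm (F u - F v) \<notin> {0, 1}"
  shows "induced_unit_copy (cycle_graph k) (F ` {..<k})"
proof -
  have "inj_on F {..<k}"
  proof (rule inj_onI, rule ccontr)
    fix u v assume uv: "u \<in> {..<k}" "v \<in> {..<k}" "F u = F v" "u \<noteq> v"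
    then have k: "u < k" "v < k" by auto
    have "norm (F u - F v) = 0" "norm (F v - F u) = 0" using uv by simp_all
    then have "v \<noteq> Suc u mod k" "u \<noteq> Suc v mod k"
      using step[OF k(1)] step[OF k(2)] by (metis zero_neq_one)+
    from far[OF k uv(4) this] show False using uv(3) by simp
  qed
  then have bij: "bij_betw F (verts (cycle_graph k)) (F ` {..<k})"
    by (simp add: bij_betw_def cycle_graph_def)
  have verts: "w \<in> verts (cycle_graph k) \<Longrightarrow> w < k" for w by (simp add: cycle_graph_def)
  show ?thesis
    unfolding induced_unit_copy_def
  proof (intro exI conjI ballI impI)
    show "bij_betw F (verts (cycle_graph k)) (F ` {..<k})" by (rule bij)
  next
    fix u v assume "u \<in> verts (cycle_graph k)" "v \<in> verts (cycle_graph k)"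
      and e: "{u, v} \<in> edges (cycle_graph k)"
    then have k: "u < k" "v < k" by (auto dest: verts)
    from e have "v = Suc u mod k \<or> u = Suc v mod k" by (simp add: cycle_graph_edge_iff[OF k])
    then show "norm (F u - F v) = 1" using step k by (metis norm_minus_commute)
  next
    fix u v assume "u \<in> verts (cycle_graph k)" "v \<in> verts (cycle_graph k)"
      and e: "{u, v} \<notin> edges (cycle_graph k)"
    then have k: "u < k" "v < k" by (auto dest: verts)
    with e show "norm (F u - F v) \<noteq> 1"
      using far[OF k] by (cases "u = v") (auto simp: cycle_graph_edge_iff[OF k])
  qed
qed

text \<open>\<open>generic\<close> concerns words that differ in at least two letters. For a single
  differing letter the isometries alone fix the distance, so varying one letter of a word traces out
  a congruent copy of V.\<close>

locale generic_words =
  fixes V :: "(real ^ 'n) set" and m :: nat and T :: "nat \<Rightarrow> real ^ 'n \<Rightarrow> real ^ 'n"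
  assumes linear_T: "linear (T i)"
    and norm_T: "norm (T i v) = norm v"
    and generic: "\<lbrakk>\<forall>i<m. w i \<in> V \<and> w' i \<in> V; 2 \<le> card {i. i < m \<and> w i \<noteq> w' i}\<rbrakk> \<Longrightarrow>
      norm ((\<Sum>i<m. T i (w i)) - (\<Sum>i<m. T i (w' i))) \<notin> {0, 1}"
begin

definition words :: "(nat \<Rightarrow> real ^ 'n) set" where
  "words = Pi\<^sub>E {..<m} (\<lambda>_. V)"

definition point :: "(nat \<Rightarrow> real ^ 'n) \<Rightarrow> real ^ 'n" where
  "point w = (\<Sum>i<m. T i (w i))"

lemma words_mem: "w \<in> words \<Longrightarrow> i < m \<Longrightarrow> w i \<in> V"
  by (auto simp: words_def)

lemma words_upd: "w \<in> words \<Longrightarrow> i < m \<Longrightarrow> v \<in> V \<Longrightarrow> w(i := v) \<in> words"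
  by (auto simp: words_def PiE_iff extensional_def)

lemma words_eqI: "w \<in> words \<Longrightarrow> w' \<in> words \<Longrightarrow> (\<And>i. i < m \<Longrightarrow> w i = w' i) \<Longrightarrow> w = w'"
  unfolding words_def by (rule PiE_ext) auto

lemma norm_point_upd:
  assumes "i < m"
  shows "norm (point (w(i := u)) - point (w(i := v))) = norm (u - v)"
proof -
  have "point (w(i := u)) - point (w(i := v)) = (\<Sum>j<m. T j ((w(i := u)) j - (w(i := v)) j))"
    unfolding point_def by (simp add: linear_diff[OF linear_T] sum_subtractf)
  also have "\<dots> = (\<Sum>j\<in>{i}. T j ((w(i := u)) j - (w(i := v)) j))"
    using assms by (intro sum.mono_neutral_right) (auto simp: linear_0[OF linear_T])
  finally show ?thesis by (simp add: norm_T)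
qed

lemma norm_point_far:
  assumes "w \<in> words" "w' \<in> words" "i < m" "j < m" "i \<noteq> j" "w i \<noteq> w' i" "w j \<noteq> w' j"
  shows "norm (point w - point w') \<notin> {0, 1}"
proof -
  have "card {i, j} \<le> card {i. i < m \<and> w i \<noteq> w' i}" using assms by (intro card_mono) auto
  then show ?thesis unfolding point_def using assms words_mem by (intro generic) auto
qed

lemma inj_on_point: "inj_on point words"
proof (rule inj_onI, rule ccontr)
  fix w w' assume w: "w \<in> words" "w' \<in> words" and eq: "point w = point w'" and "w \<noteq> w'"
  then obtain i where i: "i < m" "w i \<noteq> w' i" using words_eqI by blast
  show False
  proof (cases "\<exists>j<m. j \<noteq> i \<and> w j \<noteq> w' j")
    case True
    then obtain j where "j < m" "i \<noteq> j" "w j \<noteq> w' j" by blast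
    then show False using norm_point_far[OF w i(1) _ _ i(2)] eq by auto
  next
    case False
    have "w' = w(i := w' i)"
      using False by (intro words_eqI[OF w(2) words_upd[OF w(1) i(1) words_mem[OF w(2) i(1)]]]) auto
    then show False using norm_point_upd[OF i(1), of w "w i" "w' i"] eq i(2) by simp
  qed
qed

context
  fixes b :: "nat \<Rightarrow> real ^ 'n" and g :: "nat \<times> nat \<Rightarrow> nat" and x y :: "real ^ 'n" and t :: nat
  assumes b: "b \<in> words" and xy: "x \<in> V" "y \<in> V" "norm (x - y) = 1"
    and g: "inj_on g ({0, 1, 2} \<times> {..<t})" "g ` ({0, 1, 2} \<times> {..<t}) \<subseteq> {..<m}"
    and b_g: "\<forall>e\<in>{0, 1, 2} \<times> {..<t}. b (g e) = y"
begin

text \<open>The base word has y at all positions named by g, so S can be read off from the letters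
  there, and removing an element from S turns one x into y.\<close>

definition wd :: "(nat \<times> nat) set \<Rightarrow> nat \<Rightarrow> real ^ 'n" where
  "wd S = (\<lambda>u. if u \<in> g ` S then x else b u)"

lemma tri_subset: "i < t \<Longrightarrow> j < t \<Longrightarrow> h < t \<Longrightarrow> tri i j h \<subseteq> {0, 1, 2} \<times> {..<t}"
  by (auto simp: tri_def)

lemma wd_words:
  assumes "S \<subseteq> {0, 1, 2} \<times> {..<t}"
  shows "wd S \<in> words"
proof -
  have "g ` S \<subseteq> {..<m}" using assms g(2) by blast
  then show ?thesis using b xy(1) by (auto simp: words_def wd_def PiE_iff extensional_def)
qed

lemma wd_at: "S \<subseteq> {0, 1, 2} \<times> {..<t} \<Longrightarrow> e \<in> {0, 1, 2} \<times> {..<t} \<Longrightarrow> wd S (g e) = (if e \<in> S then x else y)"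
  unfolding wd_def using inj_on_image_mem_iff[OF g(1), of e S] bspec[OF b_g, of e] by presburger

lemma wd_remove:
  assumes "S \<subseteq> {0, 1, 2} \<times> {..<t}" "e \<in> S"
  shows "wd (S - {e}) = (wd S)(g e := y)"
proof
  fix u
  have "g ` (S - {e}) = g ` S - {g e}"
    using inj_on_image_set_diff[OF g(1), of S "{e}"] assms by auto
  then show "wd (S - {e}) u = ((wd S)(g e := y)) u"
    using assms b_g by (auto simp: wd_def)
qed

lemma norm_wd_remove:
  assumes "S \<subseteq> {0, 1, 2} \<times> {..<t}" "e \<in> S"
  shows "norm (point (wd S) - point (wd (S - {e}))) = 1"
proof -
  have e: "e \<in> {0, 1, 2} \<times> {..<t}" using assms by blast
  then have "g e < m" using g(2) by blast
  moreover have "wd S = (wd S)(g e := x)" using wd_at[OF assms(1) e] assms(2) by auto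
  ultimately show ?thesis
    using norm_point_upd[of "g e" "wd S" x y] xy(3) wd_remove[OF assms] by simp
qed

lemma norm_wd_far:
  assumes "S \<subseteq> {0, 1, 2} \<times> {..<t}" "S' \<subseteq> {0, 1, 2} \<times> {..<t}" "e \<noteq> e'" "e \<in> S - S'" "e' \<in> S' - S"
  shows "norm (point (wd S) - point (wd S')) \<notin> {0, 1}"
proof (rule norm_point_far[of _ _ "g e" "g e'"])
  have e: "e \<in> {0, 1, 2} \<times> {..<t}" "e' \<in> {0, 1, 2} \<times> {..<t}" using assms by blast+
  show "g e < m" "g e' < m" using g(2) e by blast+
  show "g e \<noteq> g e'" using inj_onD[OF g(1) _ e] assms(3) by blast
  have "x \<noteq> y" using xy(3) by auto
  then show "wd S (g e) \<noteq> wd S' (g e)" "wd S (g e') \<noteq> wd S' (g e')"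
    using wd_at[OF assms(1)] wd_at[OF assms(2)] e assms(4,5) by auto
qed (use assms wd_words in auto)

text \<open>\<open>col\<close> is kept abstract; it will be the color of the point of a word. What
  is asked of it is invariance under turning one x of a full transversal into y, and this carries
  the color along every edge of the cycle.\<close>

context
  fixes l :: nat and P L :: "nat \<Rightarrow> (nat \<times> nat) set" and col :: "(nat \<Rightarrow> real ^ 'n) \<Rightarrow> nat"
  assumes l: "3 \<le> l" "l \<le> t" and cyc: "incidence_cycle l P L"
    and col: "\<And>i j h e. i < t \<Longrightarrow> j < t \<Longrightarrow> h < t \<Longrightarrow> e \<in> tri i j h \<Longrightarrow>
      col ((wd (tri i j h))(g e := y)) = col (wd (tri i j h))"
begin

lemma cycle_words_step:
  assumes "k < 2 * l"
  shows "cycle_sets P L k \<subseteq> {0, 1, 2} \<times> {..<t}"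
    and "norm (point (wd (cycle_sets P L k)) - point (wd (cycle_sets P L (Suc k mod (2 * l))))) = 1"
    and "col (wd (cycle_sets P L (Suc k mod (2 * l)))) = col (wd (cycle_sets P L k))"
proof -
  obtain i j h e where ijh: "i < l" "j < l" "h < l" "e \<in> tri i j h" and
    S: "cycle_sets P L k = tri i j h \<and> cycle_sets P L (Suc k mod (2 * l)) = tri i j h - {e} \<and> even k \<or>
     cycle_sets P L k = tri i j h - {e} \<and> cycle_sets P L (Suc k mod (2 * l)) = tri i j h \<and> odd k"
    using cycle_sets_step[OF cyc assms] by metis
  have ijht: "i < t" "j < t" "h < t" using ijh l by auto
  note sub = tri_subset[OF ijht]
  show "cycle_sets P L k \<subseteq> {0, 1, 2} \<times> {..<t}" using S sub by blast
  show "norm (point (wd (cycle_sets P L k)) - point (wd (cycle_sets P L (Suc k mod (2 * l))))) = 1"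
    using S norm_wd_remove[OF sub ijh(4)] by (metis norm_minus_commute)
  show "col (wd (cycle_sets P L (Suc k mod (2 * l)))) = col (wd (cycle_sets P L k))"
    using S col[OF ijht ijh(4)] wd_remove[OF sub ijh(4)] by metis
qed

lemma cycle_words_far:
  assumes "u < 2 * l" "v < 2 * l" "u \<noteq> v" "v \<noteq> Suc u mod (2 * l)" "u \<noteq> Suc v mod (2 * l)"
  shows "norm (point (wd (cycle_sets P L u)) - point (wd (cycle_sets P L v))) \<notin> {0, 1}"
proof -
  obtain a b where "a \<noteq> b" "a \<in> cycle_sets P L u - cycle_sets P L v" "b \<in> cycle_sets P L v - cycle_sets P L u"
    using cycle_sets_far[OF cyc l(1) assms] by (elim exE conjE)
  then show ?thesis
    by (rule norm_wd_far[OF cycle_words_step(1)[OF assms(1)] cycle_words_step(1)[OF assms(2)]])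
qed

lemma cycle_words_color:
  assumes "k < 2 * l"
  shows "col (wd (cycle_sets P L k)) = col (wd (cycle_sets P L 0))"
  using assms
proof (induction k)
  case (Suc k)
  then show ?case using cycle_words_step(3)[of k] by simp
qed simp

end
end
end

lemma generic_words_exists:
  fixes V :: "(real ^ 'n) set"
  assumes "finite V" "CARD('n) \<ge> 2"
  shows "\<exists>T. generic_words V m T"
proof -
  have "\<exists>T :: nat \<Rightarrow> real ^ 'n \<Rightarrow> real ^ 'n. (\<forall>i. linear (T i)) \<and> (\<forall>i v. norm (T i v) = norm v) \<and>
    (\<forall>w w'. (\<forall>i<m. w i \<in> V \<and> w' i \<in> V) \<and> 2 \<le> card {i. i < m \<and> w i \<noteq> w' i} \<longrightarrow>
      norm ((\<Sum>i<m. T i (w i)) - (\<Sum>i<m. T i (w' i))) \<notin> {0, 1})"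
    by (rule generic_isometries) (use assms in simp_all)
  then obtain T :: "nat \<Rightarrow> real ^ 'n \<Rightarrow> real ^ 'n" where "\<forall>i. linear (T i)" "\<forall>i v. norm (T i v) = norm v"
    "\<forall>w w'. (\<forall>i<m. w i \<in> V \<and> w' i \<in> V) \<and> 2 \<le> card {i. i < m \<and> w i \<noteq> w' i} \<longrightarrow>
      norm ((\<Sum>i<m. T i (w i)) - (\<Sum>i<m. T i (w' i))) \<notin> {0, 1}" by (elim exE conjE)
  then have "generic_words V m T" unfolding generic_words_def by blast
  then show ?thesis by (rule exI[of "generic_words V m"])
qed

section \<open>Monochromatic cycles\<close>

text \<open>A word and a position determine a copy of V, on which c cannot be proper, so some unit
  pair of V receives equal colors there. The unit pairs are the finitely many types of the counting
  argument.\<close>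

theorem monochromatic_even_cycle:
  fixes V :: "(real ^ 'n) set" and c :: "real ^ 'n \<Rightarrow> nat"
  assumes n: "CARD('n) \<ge> 2" and V: "finite V" and c: "coloring r c" and l: "l = 4 \<or> l \<ge> 6"
    and not_colorable: "\<nexists>d :: real ^ 'n \<Rightarrow> nat. (\<forall>x\<in>V. d x < r) \<and> (\<forall>x\<in>V. \<forall>y\<in>V. dist x y = 1 \<longrightarrow> d x \<noteq> d y)"
  shows "\<exists>A. induced_unit_copy (cycle_graph (2 * l)) A \<and> monochromatic c A"
proof -
  define \<Theta> where "\<Theta> = {(x, y). x \<in> V \<and> y \<in> V \<and> dist x y = 1}"
  have "V \<noteq> {}" using not_colorable by auto
  have "finite \<Theta>" by (rule finite_subset[of _ "V \<times> V"]) (use V in \<open>auto simp: \<Theta>_def\<close>)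
  have \<Theta>: "fst \<tau> \<in> V \<and> snd \<tau> \<in> V" if "\<tau> \<in> \<Theta>" for \<tau> using that by (auto simp: \<Theta>_def)
  have "l > 0" using l by auto
  obtain m :: nat where m: "\<forall>W Good. W = Pi\<^sub>E {..<m} (\<lambda>_. V) \<longrightarrow>
    (\<forall>w\<in>W. \<forall>i<m. \<exists>\<tau>\<in>\<Theta>. Good \<tau> (w(i := fst \<tau>)) i) \<longrightarrow>
    (\<exists>\<tau>\<in>\<Theta>. \<exists>b\<in>W. \<exists>g. inj_on g ({0, 1, 2} \<times> {..<l}) \<and> g ` ({0, 1, 2} \<times> {..<l}) \<subseteq> {..<m} \<and>
      (\<forall>e\<in>{0, 1, 2} \<times> {..<l}. b (g e) = snd \<tau>) \<and>
      (\<forall>i<l. \<forall>j<l. \<forall>k<l. \<forall>e\<in>tri i j k. Good \<tau> (\<lambda>u. if u \<in> g ` tri i j k then fst \<tau> else b u) (g e)))"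
    by (rule good_grid[OF V \<open>V \<noteq> {}\<close> \<open>finite \<Theta>\<close> \<Theta> \<open>l > 0\<close>])
  obtain T where "generic_words V m T" using generic_words_exists[OF V n] by blast
  then interpret generic_words V m T .
  \<comment> \<open>\<open>Good\<close> ignores the letter of w at i, so it may be evaluated at the
    word that has x there, as the counting demands.\<close>
  define Good where "Good = (\<lambda>\<tau> w i. c (point (w(i := fst \<tau>))) = c (point (w(i := snd \<tau>))))"
  have "\<exists>\<tau>\<in>\<Theta>. Good \<tau> (w(i := fst \<tau>)) i" for w i
  proof (rule ccontr)
    assume "\<not> ?thesis"
    then have "c (point (w(i := x))) \<noteq> c (point (w(i := y)))" if "x \<in> V" "y \<in> V" "dist x y = 1" for x y
      using that by (auto simp: \<Theta>_def Good_def)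
    then have "(\<forall>x\<in>V. c (point (w(i := x))) < r) \<and>
      (\<forall>x\<in>V. \<forall>y\<in>V. dist x y = 1 \<longrightarrow> c (point (w(i := x))) \<noteq> c (point (w(i := y))))"
      using c by (simp add: coloring_def)
    then show False
      using not_colorable[unfolded not_ex, THEN spec, of "\<lambda>x. c (point (w(i := x)))"] by (rule notE[rotated])
  qed
  then have "\<forall>w\<in>words. \<forall>i<m. \<exists>\<tau>\<in>\<Theta>. Good \<tau> (w(i := fst \<tau>)) i" by blast
  from m[THEN spec, THEN spec, THEN mp, THEN mp, OF words_def this]
  obtain \<tau> b g where \<tau>: "\<tau> \<in> \<Theta>" and b: "b \<in> words"
    and g: "inj_on g ({0, 1, 2} \<times> {..<l})" "g ` ({0, 1, 2} \<times> {..<l}) \<subseteq> {..<m}"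
    and bg: "\<forall>e\<in>{0, 1, 2} \<times> {..<l}. b (g e) = snd \<tau>"
    and good: "\<forall>i<l. \<forall>j<l. \<forall>k<l. \<forall>e\<in>tri i j k. Good \<tau> (\<lambda>u. if u \<in> g ` tri i j k then fst \<tau> else b u) (g e)"
    by (elim bexE exE conjE)
  obtain P L where cyc: "incidence_cycle l P L" using incidence_cycle_exists[OF l] by (elim exE)
  define x y where "x = fst \<tau>" and "y = snd \<tau>"
  have xy: "x \<in> V" "y \<in> V" "norm (x - y) = 1" using \<tau> by (auto simp: \<Theta>_def x_def y_def dist_norm)
  note grid = b xy g bg[folded y_def]
  define f where "f = (\<lambda>k. point (wd b g x (cycle_sets P L k)))"
  have l3: "3 \<le> l" using l by auto
  have col: "c (point ((wd b g x (tri i j h))(g e := y))) = c (point (wd b g x (tri i j h)))"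
    if "i < l" "j < l" "h < l" "e \<in> tri i j h" for i j h e
  proof -
    have "Good \<tau> (wd b g x (tri i j h)) (g e)"
      unfolding wd_def[OF grid] unfolding x_def by (rule good[rule_format, OF that])
    moreover have "(wd b g x (tri i j h))(g e := x) = wd b g x (tri i j h)"
      using that(4) by (auto simp: wd_def[OF grid])
    ultimately show ?thesis by (simp add: Good_def x_def y_def)
  qed
  note cw = grid l3 order_refl cyc col
  have "induced_unit_copy (cycle_graph (2 * l)) (f ` {..<2 * l})"
    unfolding f_def
    by (rule induced_unit_copy_cycle_graph)
      (rule cycle_words_step(2)[OF cw] cycle_words_far[OF cw]; assumption)+
  moreover have "monochromatic c (f ` {..<2 * l})"
    unfolding monochromatic_def f_def
    using cycle_words_color[where col = "\<lambda>w. c (point w)", OF cw] by blast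
  ultimately show ?thesis by blast
qed

text \<open>If the color classes on a copy of V were all bipartite, splitting each in two would
  color V properly with 2 r colors. So a monochromatic odd cycle p occurs on every copy, and p
  serves as the type. The resulting copy may fail to be induced, because p may have unit
  chords.\<close>

theorem monochromatic_odd_cycle:
  fixes V :: "(real ^ 'n) set" and c :: "real ^ 'n \<Rightarrow> nat"
  assumes n: "CARD('n) \<ge> 2" and V: "finite V" and c: "coloring r c" and l: "l \<ge> card V + 6"
    and not_colorable: "\<nexists>d :: real ^ 'n \<Rightarrow> nat. (\<forall>x\<in>V. d x < 2 * r) \<and> (\<forall>x\<in>V. \<forall>y\<in>V. dist x y = 1 \<longrightarrow> d x \<noteq> d y)"
  shows "\<exists>A. unit_copy (cycle_graph (2 * l + 1)) A \<and> monochromatic c A"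
proof -
  define \<Theta> where "\<Theta> = {p. set p \<subseteq> V \<and> distinct p \<and> odd (length p) \<and> length p \<ge> 3 \<and>
    (\<forall>k<length p. dist (p ! k) (p ! (Suc k mod length p)) = 1)}"
  have "V \<noteq> {}" using not_colorable by auto
  have "finite \<Theta>" by (rule finite_subset[OF _ finite_subset_distinct[OF V]]) (auto simp: \<Theta>_def)
  have \<Theta>: "p ! 0 \<in> V \<and> p ! 1 \<in> V" if "p \<in> \<Theta>" for p
  proof -
    from that have p: "set p \<subseteq> V" "3 \<le> length p" unfolding \<Theta>_def by blast+
    from p(2) have "p ! 0 \<in> set p" "p ! 1 \<in> set p" by (auto intro!: nth_mem simp flip: length_greater_0_conv)
    then show ?thesis using p(1) by blast
  qed
  have "l > 0" using l by auto
  obtain m :: nat where m: "\<forall>W Good. W = Pi\<^sub>E {..<m} (\<lambda>_. V) \<longrightarrow>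
    (\<forall>w\<in>W. \<forall>i<m. \<exists>p\<in>\<Theta>. Good p (w(i := p ! 0)) i) \<longrightarrow>
    (\<exists>p\<in>\<Theta>. \<exists>b\<in>W. \<exists>g. inj_on g ({0, 1, 2} \<times> {..<l}) \<and> g ` ({0, 1, 2} \<times> {..<l}) \<subseteq> {..<m} \<and>
      (\<forall>e\<in>{0, 1, 2} \<times> {..<l}. b (g e) = p ! 1) \<and>
      (\<forall>i<l. \<forall>j<l. \<forall>k<l. \<forall>e\<in>tri i j k. Good p (\<lambda>u. if u \<in> g ` tri i j k then p ! 0 else b u) (g e)))"
    by (rule good_grid[OF V \<open>V \<noteq> {}\<close> \<open>finite \<Theta>\<close> \<Theta> \<open>l > 0\<close>])
  obtain T where "generic_words V m T" using generic_words_exists[OF V n] by blast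
  then interpret generic_words V m T .
  \<comment> \<open>\<open>p ! 0\<close> and \<open>p ! 1\<close> act as x and y in the even cycle.
    All letters of p share the color, so that an edge can later be rerouted along p.\<close>
  define Good where "Good = (\<lambda>p w i. \<forall>v\<in>set p. c (point (w(i := v))) = c (point (w(i := p ! 0))))"
  have "\<exists>p\<in>\<Theta>. Good p (w(i := p ! 0)) i" for w i
  proof (rule ccontr)
    assume contra: "\<not> ?thesis"
    define col where "col = (\<lambda>v. c (point (w(i := v))))"
    define E where "E = (\<lambda>x y. x \<in> V \<and> y \<in> V \<and> dist x y = 1 \<and> col x = col y)"
    have "\<exists>h :: real ^ 'n \<Rightarrow> bool. \<forall>x y. E x y \<longrightarrow> h x \<noteq> h y"
    proof (rule two_colorable_if_no_odd_cycle)
      show "symp E" by (auto simp: E_def symp_def dist_commute)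
      show "irreflp E" by (auto simp: E_def irreflp_def)
      fix p assume p: "distinct p" "odd (length p)" "3 \<le> length p"
        and step: "\<And>i. i < length p \<Longrightarrow> E (p ! i) (p ! (Suc i mod length p))"
      have "col (p ! k) = col (p ! 0)" if "k < length p" for k
        using that
      proof (induction k)
        case (Suc k)
        then show ?case using step[of k] by (simp add: E_def)
      qed simp
      moreover have "set p \<subseteq> V" using step by (auto simp: E_def in_set_conv_nth)
      ultimately have "p \<in> \<Theta>" "Good p (w(i := p ! 0)) i"
        using p step by (auto simp: \<Theta>_def E_def Good_def col_def in_set_conv_nth)
      then show False using contra by blast
    qed
    then obtain h :: "real ^ 'n \<Rightarrow> bool" where h: "\<forall>x y. E x y \<longrightarrow> h x \<noteq> h y" by (rule exE)
    have "col x < r" for x using c by (simp add: col_def coloring_def)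
    \<comment> \<open>Color and side of the bipartition are coded as one number below 2 r.\<close>
    then have bound: "2 * col x + of_bool (h x) < 2 * r" for x
      using Suc_leI[of "col x" r] by (auto simp: of_bool_def)
    have "2 * col x + of_bool (h x) \<noteq> 2 * col y + of_bool (h y)"
      if "x \<in> V" "y \<in> V" "dist x y = 1" for x y
    proof
      assume eq: "2 * col x + of_bool (h x) = 2 * col y + of_bool (h y)"
      then have "col x = col y" by (auto simp: of_bool_def split: if_splits)
      then show False using eq h[rule_format, of x y] that by (auto simp: E_def of_bool_def split: if_splits)
    qed
    with bound have "(\<forall>x\<in>V. 2 * col x + of_bool (h x) < 2 * r) \<and>
      (\<forall>x\<in>V. \<forall>y\<in>V. dist x y = 1 \<longrightarrow> 2 * col x + of_bool (h x) \<noteq> 2 * col y + of_bool (h y))" by blast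
    then show False
      using not_colorable[unfolded not_ex, THEN spec, of "\<lambda>x. 2 * col x + of_bool (h x)"]
      by (rule notE[rotated])
  qed
  then have "\<forall>w\<in>words. \<forall>i<m. \<exists>p\<in>\<Theta>. Good p (w(i := p ! 0)) i" by blast
  from m[THEN spec, THEN spec, THEN mp, THEN mp, OF words_def this]
  obtain p b g where p: "p \<in> \<Theta>" and b: "b \<in> words"
    and g: "inj_on g ({0, 1, 2} \<times> {..<l})" "g ` ({0, 1, 2} \<times> {..<l}) \<subseteq> {..<m}"
    and bg: "\<forall>e\<in>{0, 1, 2} \<times> {..<l}. b (g e) = p ! 1"
    and good: "\<forall>i<l. \<forall>j<l. \<forall>k<l. \<forall>e\<in>tri i j k. Good p (\<lambda>u. if u \<in> g ` tri i j k then p ! 0 else b u) (g e)"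
    by (elim bexE exE conjE)
  have p': "set p \<subseteq> V" "distinct p" "3 \<le> length p"
    and pstep: "\<And>k. k < length p \<Longrightarrow> norm (p ! k - p ! (Suc k mod length p)) = 1"
    using p by (auto simp: \<Theta>_def dist_norm)
  have "odd (length p)" using p by (simp add: \<Theta>_def)
  then obtain q where q: "length p = 2 * q + 1" by (rule oddE)
  have "length p \<le> card V" using p' V by (metis card_mono distinct_card)
  \<comment> \<open>Rerouting one edge of a cycle with 2 l' vertices through the 2 q - 1 other
    vertices of p gives 2 l + 1 vertices. As 2 q + 1 \<le> \<open>card V\<close>, the bound on l
    leaves l' \<ge> 6 whatever p is.\<close>
  define l' where "l' = l + 1 - q"
  have l': "l' \<ge> 6" "l' \<le> l" "2 * l + 1 = 2 * l' + 2 * q - 1" "q \<ge> 1"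
    using l q p'(3) \<open>length p \<le> card V\<close> by (auto simp: l'_def)
  obtain P L where cyc: "incidence_cycle l' P L" using incidence_cycle_exists[of l'] l' by auto
  define x y where "x = p ! 0" and "y = p ! 1"
  have "p \<noteq> []" using p'(3) by auto
  then have xy: "x \<in> V" "y \<in> V" "norm (x - y) = 1"
    using \<Theta>[OF p] pstep[of 0] p'(3) by (auto simp: x_def y_def)
  note grid = b xy g bg[folded y_def]
  have good': "c (point ((wd b g x (tri i j h))(g e := v))) = c (point (wd b g x (tri i j h)))"
    if "i < l" "j < l" "h < l" "e \<in> tri i j h" "v \<in> set p" for i j h e v
  proof -
    have "Good p (wd b g x (tri i j h)) (g e)"
      unfolding wd_def[OF grid] unfolding x_def by (rule good[rule_format, OF that(1-4)])
    moreover have "(wd b g x (tri i j h))(g e := x) = wd b g x (tri i j h)"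
      using that(4) by (auto simp: wd_def[OF grid])
    ultimately show ?thesis using that(5) by (simp add: Good_def x_def)
  qed
  have "y \<in> set p" using p'(3) by (simp add: y_def)
  then have col: "c (point ((wd b g x (tri i j h))(g e := y))) = c (point (wd b g x (tri i j h)))"
    if "i < l" "j < l" "h < l" "e \<in> tri i j h" for i j h e using good' that by blast
  have l3: "3 \<le> l'" using l' by simp
  note cw = grid l3 l'(2) cyc col
  have last: "2 * l' - 1 < 2 * l'" "odd (2 * l' - 1)" "Suc (2 * l' - 1) mod (2 * l') = 0" using l' by auto
  \<comment> \<open>The edge to be rerouted joins the last vertex to the first; their words have y
    and x, respectively, at the position of e.\<close>
  obtain i j h e where ijh: "i < l'" "j < l'" "h < l'" and e: "e \<in> tri i j h"
    and S: "cycle_sets P L (2 * l' - 1) = tri i j h - {e}" "cycle_sets P L 0 = tri i j h"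
    using cycle_sets_step[OF cyc last(1)] last(2,3) by metis
  have ijhl: "i < l" "j < l" "h < l" using ijh l' by auto
  note sub = tri_subset[OF grid ijhl]
  have eG: "e \<in> {0, 1, 2} \<times> {..<l}" using sub e by blast
  define w0 where "w0 = wd b g x (tri i j h)"
  define i0 where "i0 = g e"
  have i0: "i0 < m" using g(2) eG by (auto simp: i0_def)
  have w0: "w0 \<in> words" unfolding w0_def by (rule wd_words[OF grid sub])
  have w0x: "w0(i0 := x) = w0" using wd_at[OF grid sub eG] e by (auto simp: w0_def i0_def)
  \<comment> \<open>The index k + 2 - 2 l' equals 1 at k = 2 l' - 1, so the last word of the even
    cycle already has the form of the words on the arc. At k = 2 l it reaches the last letter of
    p.\<close>
  define f where "f = (\<lambda>k. if k < 2 * l' then wd b g x (cycle_sets P L k) else w0(i0 := p ! (k + 2 - 2 * l')))"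
  have f_tail: "f k = w0(i0 := p ! (k + 2 - 2 * l'))" if "k \<ge> 2 * l' - 1" for k
  proof (cases "k = 2 * l' - 1")
    case True
    then have "k + 2 - 2 * l' = 1" "k < 2 * l'" using l' by auto
    then show ?thesis
      using True S(1) wd_remove[OF grid sub e] by (simp add: f_def w0_def i0_def y_def)
  next
    case False
    then have "\<not> k < 2 * l'" using that by linarith
    then show ?thesis by (simp add: f_def)
  qed
  have f0: "f 0 = w0" using l' S(2) by (simp add: f_def w0_def)
  have subk: "cycle_sets P L k \<subseteq> {0, 1, 2} \<times> {..<l}" if "k < 2 * l'" for k
    by (rule cycle_words_step(1)[OF cw that])
  have mem: "f k \<in> words" if "k < 2 * l + 1" for k
  proof (cases "k < 2 * l'")
    case True
    then show ?thesis using wd_words[OF grid subk] by (simp add: f_def)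
  next
    case False
    then have "k + 2 - 2 * l' < length p" using that l' q by linarith
    then have "p ! (k + 2 - 2 * l') \<in> V" using p'(1) nth_mem by blast
    then show ?thesis using False words_upd[OF w0 i0] by (simp add: f_def)
  qed
  \<comment> \<open>Words of the even cycle have \<open>p ! 0\<close> or \<open>p ! 1\<close> at
    \<open>i0\<close>, the inner words of the arc another letter of p; this separates the two
    kinds.\<close>
  have f_i0: "f k i0 \<in> {p ! 0, p ! 1}" if "k < 2 * l'" for k
    using that wd_at[OF grid subk[OF that] eG] by (simp add: f_def i0_def x_def y_def)
  have tail_neq: "f u \<noteq> f v" if uv: "u < v" "v < 2 * l + 1" "2 * l' \<le> v" for u v
  proof
    assume eq: "f u = f v"
    have v: "v + 2 - 2 * l' < length p" "2 \<le> v + 2 - 2 * l'" using uv l' q by linarith+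
    have fv: "f v i0 = p ! (v + 2 - 2 * l')" using uv by (simp add: f_tail)
    show False
    proof (cases "u < 2 * l'")
      case True
      then have "p ! (v + 2 - 2 * l') \<in> {p ! 0, p ! 1}" using f_i0[OF True] eq fv by simp
      moreover have "0 < length p" "1 < length p" using p'(3) by linarith+
      ultimately show False
        using v(2) nth_eq_iff_index_eq[OF p'(2) v(1), of 0] nth_eq_iff_index_eq[OF p'(2) v(1), of 1] by auto
    next
      case False
      then have "f u i0 = p ! (u + 2 - 2 * l')" by (simp add: f_tail)
      then have "u + 2 - 2 * l' = v + 2 - 2 * l'"
        using eq fv v uv p'(2) nth_eq_iff_index_eq[of p "u + 2 - 2 * l'" "v + 2 - 2 * l'"] by simp
      then show False using uv False by simp
    qed
  qed
  have head: "norm (point (f u) - point (f (Suc u mod (2 * l')))) = 1" if "u < 2 * l'" for u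
    using cycle_words_step(2)[OF cw that] that l' by (simp add: f_def)
  have "f u \<noteq> f v" if uv: "u < 2 * l'" "v < 2 * l'" "u \<noteq> v" for u v
  proof
    assume eq: "f u = f v"
    then have "norm (point (f u) - point (f v)) = 0" "norm (point (f v) - point (f u)) = 0" by simp_all
    then have "v \<noteq> Suc u mod (2 * l')" "u \<noteq> Suc v mod (2 * l')"
      using head[OF uv(1)] head[OF uv(2)] by (metis zero_neq_one)+
    from cycle_words_far[OF cw uv this] show False using eq uv by (simp add: f_def)
  qed
  then have "f u \<noteq> f v" if "u < 2 * l + 1" "v < 2 * l + 1" "u < v" for u v
    using tail_neq[of u v] that by (cases "v < 2 * l'") auto
  then have "inj_on f {..<2 * l + 1}" by (rule linorder_inj_onI') auto
  moreover have "inj_on point (f ` {..<2 * l + 1})" by (rule inj_on_subset[OF inj_on_point]) (use mem in auto)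
  ultimately have inj: "inj_on (\<lambda>k. point (f k)) {..<2 * l + 1}"
    using comp_inj_on[of f _ point] by (simp add: comp_def)
  have step: "norm (point (f k) - point (f (Suc k mod (2 * l + 1)))) = 1" if k: "k < 2 * l + 1" for k
  proof (cases "k < 2 * l' - 1")
    case True
    then have "Suc k mod (2 * l') = Suc k" "Suc k mod (2 * l + 1) = Suc k" using l' by auto
    then show ?thesis using head[of k] True by simp
  next
    case False
    define a where "a = k + 2 - 2 * l'"
    have a: "a < length p" using k l' q unfolding a_def by linarith
    have fk: "f k = w0(i0 := p ! a)" using f_tail[of k] False by (simp add: a_def)
    have "f (Suc k mod (2 * l + 1)) = w0(i0 := p ! (Suc a mod length p))"
    proof (cases "k = 2 * l")
      case True
      then have "Suc a = length p" using l' q by (simp add: a_def)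
      then have "Suc a mod length p = 0" by simp
      then show ?thesis using True f0 w0x by (simp add: x_def)
    next
      case False
      then have "Suc k mod (2 * l + 1) = Suc k" using k by simp
      moreover have "Suc a < length p" using k False l' q unfolding a_def by linarith
      moreover have "Suc k + 2 - 2 * l' = Suc a" using \<open>\<not> k < 2 * l' - 1\<close> unfolding a_def by linarith
      ultimately show ?thesis using f_tail[of "Suc k"] \<open>\<not> k < 2 * l' - 1\<close> by simp
    qed
    then show ?thesis using norm_point_upd[OF i0] pstep[OF a] fk by simp
  qed
  have "c (point (f k)) = c (point w0)" if k: "k < 2 * l + 1" for k
  proof (cases "k < 2 * l'")
    case True
    then show ?thesis
      using cycle_words_color[where col = "\<lambda>w. c (point w)", OF cw True] f0 l' by (simp add: f_def)
  next
    case False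
    then have "k + 2 - 2 * l' < length p" using k l' q by linarith
    then have "p ! (k + 2 - 2 * l') \<in> set p" by simp
    then show ?thesis using good'[OF ijhl e] False by (simp add: f_tail w0_def i0_def)
  qed
  then have "monochromatic c ((\<lambda>k. point (f k)) ` {..<2 * l + 1})"
    unfolding monochromatic_def by blast
  moreover have "unit_copy (cycle_graph (2 * l + 1)) ((\<lambda>k. point (f k)) ` {..<2 * l + 1})"
    by (rule unit_copy_cycle_graph[OF inj step])
  ultimately show ?thesis by blast
qed

section \<open>Forests\<close>

text \<open>The start of a longest path has this property: a neighbour off the path would prolong
  it, and one beyond the next vertex of the path would close a cycle. Isolated vertices are
  included.\<close>

lemma acyclic_low_degree_vertex:
  fixes H :: "'v ugraph"
  assumes fin: "finite (verts H)" and ne: "verts H \<noteq> {}"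
    and simple: "\<And>e. e \<in> edges H \<Longrightarrow> e \<subseteq> verts H \<and> card e = 2"
    and acyclic: "\<nexists>vs. is_cycle H vs"
  shows "\<exists>v\<in>verts H. \<forall>u u'. {v, u} \<in> edges H \<longrightarrow> {v, u'} \<in> edges H \<longrightarrow> u = u'"
proof -
  define path where "path = (\<lambda>vs. vs \<noteq> [] \<and> distinct vs \<and> set vs \<subseteq> verts H \<and>
    (\<forall>i. Suc i < length vs \<longrightarrow> {vs ! i, vs ! Suc i} \<in> edges H))"
  obtain v0 where "v0 \<in> verts H" using ne by blast
  then have "path [v0]" by (simp add: path_def)
  moreover have "length vs < Suc (card (verts H))" if "path vs" for vs
    using that card_mono[OF fin, of "set vs"] by (simp add: path_def distinct_card)
  ultimately obtain vs where vs: "path vs" and longest: "\<And>us. path us \<Longrightarrow> length us \<le> length vs"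
    using ex_has_greatest_nat[of path "[v0]" length "Suc (card (verts H))"] by (metis less_imp_le)
  define v where "v = vs ! 0"
  have nvs: "vs \<noteq> []" and dist: "distinct vs" and sub: "set vs \<subseteq> verts H"
    and edge: "\<And>i. Suc i < length vs \<Longrightarrow> {vs ! i, vs ! Suc i} \<in> edges H"
    using vs by (auto simp: path_def)
  have v: "v \<in> verts H" using nvs sub nth_mem[of 0 vs] by (auto simp: v_def)
  have neigh: "\<exists>j. j = 1 \<and> j < length vs \<and> u = vs ! j" if u: "{v, u} \<in> edges H" for u
  proof -
    have "u \<noteq> v" "u \<in> verts H" using simple[OF u] by auto
    have "u \<in> set vs"
    proof (rule ccontr)
      assume "u \<notin> set vs"
      have "{(u # vs) ! i, (u # vs) ! Suc i} \<in> edges H" if "Suc i < length (u # vs)" for i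
        using that u edge by (cases i) (auto simp: v_def insert_commute)
      then have "path (u # vs)"
        using \<open>u \<notin> set vs\<close> \<open>u \<in> verts H\<close> dist sub by (auto simp: path_def)
      then show False using longest[of "u # vs"] by simp
    qed
    then obtain j where j: "j < length vs" "u = vs ! j" by (metis in_set_conv_nth)
    then have "j \<noteq> 0" using \<open>u \<noteq> v\<close> by (metis v_def)
    have "\<not> j \<ge> 2"
    proof
      assume "j \<ge> 2"
      have "is_cycle H (take (Suc j) vs)"
        unfolding is_cycle_def
      proof (intro conjI allI impI)
        show "3 \<le> length (take (Suc j) vs)" using j \<open>j \<ge> 2\<close> by simp
        show "distinct (take (Suc j) vs)" using dist by simp
        show "set (take (Suc j) vs) \<subseteq> verts H" by (rule order_trans[OF set_take_subset sub])
        fix i assume i: "i < length (take (Suc j) vs)"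
        have len: "length (take (Suc j) vs) = Suc j" using j by simp
        show "{take (Suc j) vs ! i, take (Suc j) vs ! (Suc i mod length (take (Suc j) vs))} \<in> edges H"
        proof (cases "i = j")
          case True
          then show ?thesis using u j unfolding len by (simp add: v_def insert_commute)
        next
          case False
          then have "i < j" using i len by simp
          then show ?thesis using edge[of i] j unfolding len by simp
        qed
      qed
      then show False using acyclic by blast
    qed
    then show ?thesis using j \<open>j \<noteq> 0\<close> by (intro exI[of _ j]) auto
  qed
  then have "\<forall>u u'. {v, u} \<in> edges H \<longrightarrow> {v, u'} \<in> edges H \<longrightarrow> u = u'" by metis
  then show ?thesis using v by blast
qed

section \<open>Induced forests among the words\<close>

context generic_words
begin

text \<open>Coordinates are counted rather than neighbours: the embedding needs fresh coordinates,
  and several neighbours of a word may share one.\<close>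

definition directions :: "((nat \<Rightarrow> real ^ 'n) \<Rightarrow> nat) \<Rightarrow> (nat \<Rightarrow> real ^ 'n) set \<Rightarrow> (nat \<Rightarrow> real ^ 'n) \<Rightarrow> nat set" where
  "directions col U w = {i. i < m \<and> (\<exists>v\<in>V. w(i := v) \<in> U \<and> norm (w i - v) = 1 \<and> col (w(i := v)) = col w)}"

text \<open>Deleting a word with fewer than \<open>p\<close> directions destroys a bounded number of monochromatic edges,
  whereas their total number grows linearly in \<open>m\<close>.\<close>

lemma many_directions_subset:
  assumes V: "finite V" "V \<noteq> {}" and m: "m > 2 * p * (card V)\<^sup>2"
    and mono: "\<And>w i. w \<in> words \<Longrightarrow> i < m \<Longrightarrow>
      \<exists>x\<in>V. \<exists>y\<in>V. norm (x - y) = 1 \<and> col (w(i := x)) = col (w(i := y))"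
  shows "\<exists>U\<subseteq>words. U \<noteq> {} \<and> (\<forall>w\<in>U. p \<le> card (directions col U w))"
proof (rule ccontr)
  assume contra: "\<not> ?thesis"
  \<comment> \<open>For U inside \<open>words\<close> this lists the monochromatic edges within U,
    each in both orientations.\<close>
  define E where "E = (\<lambda>U. {(w, i, v). w \<in> U \<and> i < m \<and> v \<in> V \<and> w(i := v) \<in> U \<and>
    norm (w i - v) = 1 \<and> col (w(i := v)) = col w})"
  have fin: "finite words" unfolding words_def using V by (intro finite_PiE) auto
  have ne: "words \<noteq> {}" unfolding words_def using V by (simp add: PiE_eq_empty_iff)
  have finE: "finite (E U)" if "U \<subseteq> words" for U
    by (rule finite_subset[of _ "words \<times> {..<m} \<times> V"]) (use that fin V in \<open>auto simp: E_def\<close>)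
  have upper: "card (E U) \<le> 2 * p * card V * card U" if "U \<subseteq> words" for U
    using that
  proof (induction "card U" arbitrary: U)
    case 0
    then have "U = {}" using fin finite_subset by fastforce
    then show ?case by (simp add: E_def)
  next
    case (Suc n)
    have "U \<noteq> {}" using Suc.hyps(2) by auto
    then obtain w where w: "w \<in> U" "card (directions col U w) < p"
      using contra Suc.prems by (meson not_le)
    define D where "D = directions col U w"
    have "finite D" unfolding D_def directions_def by simp
    \<comment> \<open>An edge at w leaves w or enters it; either kind is indexed by a direction of w
      and a letter, whence the factor 2.\<close>
    have "E U \<subseteq> E (U - {w}) \<union> (\<lambda>(i, v). (w, i, v)) ` (D \<times> V) \<union> (\<lambda>(i, v). (w(i := v), i, w i)) ` (D \<times> V)"
    proof
      fix z assume "z \<in> E U"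
      then obtain w' i v where z: "z = (w', i, v)" and h: "w' \<in> U" "i < m" "v \<in> V" "w'(i := v) \<in> U"
        "norm (w' i - v) = 1" "col (w'(i := v)) = col w'" by (auto simp: E_def)
      consider "w' = w" | "w'(i := v) = w" | "w' \<noteq> w" "w'(i := v) \<noteq> w" by blast
      then show "z \<in> E (U - {w}) \<union> (\<lambda>(i, v). (w, i, v)) ` (D \<times> V) \<union> (\<lambda>(i, v). (w(i := v), i, w i)) ` (D \<times> V)"
      proof cases
        case 1
        then have "i \<in> D" using h by (auto simp: D_def directions_def)
        then show ?thesis using 1 h z by auto
      next
        case 2
        then have w': "w(i := w' i) = w'" "w i = v" by auto
        have "w' i \<in> V" using words_mem h Suc.prems by blast
        moreover have "i \<in> D" unfolding D_def directions_def
          using w' h 2 calculation by (auto simp: norm_minus_commute intro!: bexI[of _ "w' i"])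
        ultimately have "(w(i := w' i), i, w i) \<in> (\<lambda>(i, v). (w(i := v), i, w i)) ` (D \<times> V)" by force
        then show ?thesis using z w' by simp
      next
        case 3
        then show ?thesis using h z by (auto simp: E_def)
      qed
    qed
    then have "card (E U) \<le> card (E (U - {w}) \<union> (\<lambda>(i, v). (w, i, v)) ` (D \<times> V) \<union> (\<lambda>(i, v). (w(i := v), i, w i)) ` (D \<times> V))"
      using finE[of "U - {w}"] Suc.prems \<open>finite D\<close> V by (intro card_mono) auto
    also have "\<dots> \<le> card (E (U - {w})) + card (D \<times> V) + card (D \<times> V)"
      by (intro order_trans[OF card_Un_le] add_mono card_image_le order_refl finite_SigmaI)
        (use \<open>finite D\<close> V in auto)
    also have "\<dots> \<le> 2 * p * card V * card (U - {w}) + 2 * (p * card V)"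
    proof -
      have "card (E (U - {w})) \<le> 2 * p * card V * card (U - {w})"
        using Suc.hyps(2) Suc.prems w(1) by (intro Suc.hyps(1)) auto
      moreover have "card (D \<times> V) \<le> p * card V"
        using w(2) by (simp add: card_cartesian_product D_def)
      ultimately show ?thesis by linarith
    qed
    also have "\<dots> = 2 * p * card V * Suc (card (U - {w}))" by (simp add: algebra_simps)
    also have "Suc (card (U - {w})) = card U" using Suc.hyps(2) w(1) by simp
    finally show ?case .
  qed
  \<comment> \<open>Each coordinate is a direction of at least one in \<open>card V\<close> words.
    This factor and the one in the upper bound explain the square in the bound on m.\<close>
  have "m * card words = (\<Sum>i<m. card words)" by simp
  also have "\<dots> \<le> (\<Sum>i<m. card V * card {w\<in>words. i \<in> directions col words w})"
  proof (rule sum_mono)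
    fix i assume "i \<in> {..<m}"
    then have i: "i < m" by simp
    show "card words \<le> card V * card {w\<in>words. i \<in> directions col words w}"
    proof (rule card_words_le_good_words[OF V(1) i words_def])
      fix w assume w: "w \<in> words"
      then obtain x y where xy: "x \<in> V" "y \<in> V" "norm (x - y) = 1" "col (w(i := x)) = col (w(i := y))"
        using mono i by blast
      then have "i \<in> directions col words (w(i := x))"
        using words_upd[OF w i] i by (auto simp: directions_def intro!: bexI[of _ y])
      then show "\<exists>v\<in>V. i \<in> directions col words (w(i := v))" using xy(1) by blast
    qed
  qed
  also have "\<dots> = card V * (\<Sum>w\<in>words. card {i\<in>{..<m}. i \<in> directions col words w})"
    using sum_card_swap[OF fin, of "{..<m}" "\<lambda>w i. i \<in> directions col words w"]
    by (simp add: sum_distrib_left)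
  also have "(\<Sum>w\<in>words. card {i\<in>{..<m}. i \<in> directions col words w}) \<le> card (E words)"
  proof -
    have "(\<Sum>w\<in>words. card {i\<in>{..<m}. i \<in> directions col words w})
      = card (SIGMA w:words. {i\<in>{..<m}. i \<in> directions col words w})"
      using fin by (intro card_SigmaI[symmetric]) auto
    also have "(SIGMA w:words. {i\<in>{..<m}. i \<in> directions col words w}) \<subseteq> (\<lambda>(w, i, v). (w, i)) ` E words"
      by (force simp: directions_def E_def image_iff)
    then have "card (SIGMA w:words. {i\<in>{..<m}. i \<in> directions col words w}) \<le> card ((\<lambda>(w, i, v). (w, i)) ` E words)"
      using finE[of words] by (intro card_mono) auto
    also have "\<dots> \<le> card (E words)" using finE[of words] by (intro card_image_le) auto
    finally show ?thesis .
  qed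
  also have "card V * card (E words) \<le> card V * (2 * p * card V * card words)"
    using upper[of words] by simp
  also have "\<dots> = (2 * p * (card V)\<^sup>2) * card words" by (simp add: power2_eq_square)
  finally have "m * card words \<le> (2 * p * (card V)\<^sup>2) * card words" by simp
  moreover have "card words > 0" using fin ne by (simp add: card_gt_0_iff)
  ultimately show False using m by simp
qed

lemma new_direction:
  assumes U: "U \<subseteq> words" "\<forall>w\<in>U. p \<le> card (directions col U w)" and w: "w \<in> U"
    and J: "finite J" "card J < p"
  obtains i v where "i < m" "i \<notin> J" "w(i := v) \<in> U" "v \<noteq> w i"
    "norm (point (w(i := v)) - point w) = 1" "col (w(i := v)) = col w"
proof -
  have "\<not> directions col U w \<subseteq> J" using U(2) w J card_mono[OF J(1)] by (meson leD le_trans)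
  then obtain i where i: "i \<in> directions col U w" "i \<notin> J" by blast
  then obtain v where v: "i < m" "w(i := v) \<in> U" "norm (w i - v) = 1" "col (w(i := v)) = col w"
    by (auto simp: directions_def)
  moreover have "norm (point (w(i := v)) - point w) = 1"
    using norm_point_upd[OF v(1), of w v "w i"] v(3) by (simp add: norm_minus_commute)
  moreover have "v \<noteq> w i" using v(3) by auto
  ultimately show ?thesis using that i(2) by blast
qed

text \<open>Vertices are added in the reverse order of leaf removal, and all images agree outside J.
  A leaf changes one letter of the image of its neighbour at a fresh coordinate; it differs from any
  other image there and at some coordinate of J. An isolated vertex changes two fresh letters. So
  each vertex costs at most two coordinates.\<close>

lemma forest_words:
  fixes H :: "'v ugraph"
  assumes U: "U \<subseteq> words" "U \<noteq> {}" "\<forall>w\<in>U. p \<le> card (directions col U w)"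
    and "finite (verts H)" "\<forall>e\<in>edges H. e \<subseteq> verts H \<and> card e = 2" "\<nexists>vs. is_cycle H vs"
    and "2 * card (verts H) \<le> p"
  shows "\<exists>f J. finite J \<and> card J \<le> 2 * card (verts H) \<and>
    (\<forall>u\<in>verts H. f u \<in> U) \<and>
    (\<forall>u\<in>verts H. \<forall>u'\<in>verts H. col (f u) = col (f u')) \<and>
    (\<forall>u\<in>verts H. \<forall>u'\<in>verts H. \<forall>i. f u i \<noteq> f u' i \<longrightarrow> i < m \<and> i \<in> J) \<and>
    (\<forall>u\<in>verts H. \<forall>u'\<in>verts H. u \<noteq> u' \<longrightarrow> f u \<noteq> f u') \<and>
    (\<forall>u\<in>verts H. \<forall>u'\<in>verts H. {u, u'} \<in> edges H \<longrightarrow> norm (point (f u) - point (f u')) = 1) \<and>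
    (\<forall>u\<in>verts H. \<forall>u'\<in>verts H. u \<noteq> u' \<longrightarrow> {u, u'} \<notin> edges H \<longrightarrow>
      (\<exists>i j. i \<noteq> j \<and> f u i \<noteq> f u' i \<and> f u j \<noteq> f u' j))"
  using assms(4-7)
proof (induction "card (verts H)" arbitrary: H)
  case 0
  then show ?case by (intro exI[of _ "\<lambda>_. undefined"] exI[of _ "{}"]) auto
next
  case (Suc n)
  have ne: "verts H \<noteq> {}" using Suc.hyps(2) by auto
  obtain v where v: "v \<in> verts H"
    and deg: "\<forall>u u'. {v, u} \<in> edges H \<longrightarrow> {v, u'} \<in> edges H \<longrightarrow> u = u'"
    using acyclic_low_degree_vertex[OF Suc.prems(1) ne _ Suc.prems(3)] Suc.prems(2) by blast
  define H' where "H' = \<lparr>verts = verts H - {v}, edges = {e \<in> edges H. v \<notin> e}\<rparr>"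
  have H': "verts H' = verts H - {v}" "edges H' = {e \<in> edges H. v \<notin> e}" by (simp_all add: H'_def)
  have card: "card (verts H) = Suc (card (verts H'))" 
    unfolding H'(1) by (rule card_Suc_Diff1[OF Suc.prems(1) v, symmetric])
  have "is_cycle H vs" if "is_cycle H' vs" for vs using that by (auto simp: is_cycle_def H')
  then have "\<nexists>vs. is_cycle H' vs" using Suc.prems(3) by blast
  moreover have "n = card (verts H')" using card Suc.hyps(2) by simp
  moreover have "finite (verts H')" "\<forall>e\<in>edges H'. e \<subseteq> verts H' \<and> card e = 2" "2 * card (verts H') \<le> p"
    using Suc.prems card by (auto simp: H')
  ultimately obtain f J where J: "finite J" "card J \<le> 2 * card (verts H')"
    and fU: "\<forall>u\<in>verts H'. f u \<in> U"
    and col: "\<forall>u\<in>verts H'. \<forall>u'\<in>verts H'. col (f u) = col (f u')"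
    and diff: "\<forall>u\<in>verts H'. \<forall>u'\<in>verts H'. \<forall>i. f u i \<noteq> f u' i \<longrightarrow> i < m \<and> i \<in> J"
    and inj: "\<forall>u\<in>verts H'. \<forall>u'\<in>verts H'. u \<noteq> u' \<longrightarrow> f u \<noteq> f u'"
    and adj: "\<forall>u\<in>verts H'. \<forall>u'\<in>verts H'. {u, u'} \<in> edges H' \<longrightarrow> norm (point (f u) - point (f u')) = 1"
    and far: "\<forall>u\<in>verts H'. \<forall>u'\<in>verts H'. u \<noteq> u' \<longrightarrow> {u, u'} \<notin> edges H' \<longrightarrow>
      (\<exists>i j. i \<noteq> j \<and> f u i \<noteq> f u' i \<and> f u j \<noteq> f u' j)"
    using Suc.hyps(1)[of H'] by (elim meta_impE exE conjE) assumption+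
  \<comment> \<open>The bookkeeping common to three cases: v is a leaf, a further isolated vertex,
    or the very first vertex.\<close>
  have extend: ?case
    if w: "w \<in> U" and J': "finite J'" "J \<subseteq> J'" "card J' \<le> card J + 2"
      and wcol: "\<forall>u\<in>verts H'. col w = col (f u)"
      and wdiff: "\<forall>u\<in>verts H'. \<forall>i. w i \<noteq> f u i \<longrightarrow> i < m \<and> i \<in> J'"
      and winj: "\<forall>u\<in>verts H'. w \<noteq> f u"
      and wadj: "\<forall>u\<in>verts H'. {v, u} \<in> edges H \<longrightarrow> norm (point w - point (f u)) = 1"
      and wfar: "\<forall>u\<in>verts H'. {v, u} \<notin> edges H \<longrightarrow> (\<exists>i j. i \<noteq> j \<and> w i \<noteq> f u i \<and> w j \<noteq> f u j)"
    for w J'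
  proof -
    define F where "F = f(v := w)"
    have Fv: "F v = w" and Fu: "\<And>u. u \<in> verts H' \<Longrightarrow> F u = f u" by (auto simp: F_def H')
    have split: "(\<forall>u\<in>verts H. \<forall>u'\<in>verts H. Q u u') \<longleftrightarrow>
      Q v v \<and> (\<forall>u\<in>verts H'. Q v u \<and> Q u v) \<and> (\<forall>u\<in>verts H'. \<forall>u'\<in>verts H'. Q u u')" for Q
      using v by (auto simp: H')
    have loop: "{v, v} \<notin> edges H" using Suc.prems(2) by auto
    have old: "{u, u'} \<in> edges H' \<longleftrightarrow> {u, u'} \<in> edges H" if "u \<in> verts H'" "u' \<in> verts H'" for u u'
      using that by (auto simp: H')
    show ?case
    proof (intro exI[of _ F] exI[of _ J'] conjI)
      show "finite J'" by fact
      show "card J' \<le> 2 * card (verts H)" using J' J card by simp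
      show "\<forall>u\<in>verts H. F u \<in> U" using w fU Fv Fu by (auto simp: F_def H')
      show "\<forall>u\<in>verts H. \<forall>u'\<in>verts H. col (F u) = col (F u')"
      proof (unfold split, intro conjI ballI)
        fix u assume u: "u \<in> verts H'"
        show "col (F v) = col (F u)" "col (F u) = col (F v)"
          unfolding Fv Fu[OF u] using bspec[OF wcol u] by simp_all
      next
        fix u u' assume u: "u \<in> verts H'" "u' \<in> verts H'"
        show "col (F u) = col (F u')" unfolding Fu[OF u(1)] Fu[OF u(2)] using col u by blast
      qed simp
      show "\<forall>u\<in>verts H. \<forall>u'\<in>verts H. \<forall>i. F u i \<noteq> F u' i \<longrightarrow> i < m \<and> i \<in> J'"
      proof (unfold split, intro conjI ballI allI impI)
        fix u u' i assume "u \<in> verts H'" "u' \<in> verts H'" "F u i \<noteq> F u' i"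
        then show "i < m" "i \<in> J'" using diff J'(2) by (auto simp: Fu)
      next
        fix u i assume "u \<in> verts H'" "F v i \<noteq> F u i"
        then show "i < m" "i \<in> J'" using wdiff by (auto simp: Fu Fv)
      next
        fix u i assume "u \<in> verts H'" "F u i \<noteq> F v i"
        then have "w i \<noteq> f u i" by (auto simp: Fu Fv)
        then show "i < m" "i \<in> J'" using wdiff \<open>u \<in> verts H'\<close> by auto
      qed auto
      show "\<forall>u\<in>verts H. \<forall>u'\<in>verts H. u \<noteq> u' \<longrightarrow> F u \<noteq> F u'"
      proof (unfold split, intro conjI ballI impI)
        fix u assume u: "u \<in> verts H'"
        show "F v \<noteq> F u" "F u \<noteq> F v" unfolding Fv Fu[OF u] using bspec[OF winj u] by metis+
      next
        fix u u' assume u: "u \<in> verts H'" "u' \<in> verts H'" "u \<noteq> u'"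
        show "F u \<noteq> F u'" unfolding Fu[OF u(1)] Fu[OF u(2)] using inj u by blast
      qed simp
      show "\<forall>u\<in>verts H. \<forall>u'\<in>verts H. {u, u'} \<in> edges H \<longrightarrow> norm (point (F u) - point (F u')) = 1"
      proof (unfold split, intro conjI ballI impI)
        fix u assume u: "u \<in> verts H'" "{v, u} \<in> edges H"
        show "norm (point (F v) - point (F u)) = 1" unfolding Fv Fu[OF u(1)] using wadj u by blast
      next
        fix u assume u: "u \<in> verts H'" "{u, v} \<in> edges H"
        then have "norm (point w - point (f u)) = 1" using wadj by (simp add: insert_commute)
        then show "norm (point (F u) - point (F v)) = 1"
          unfolding Fv Fu[OF u(1)] by (simp add: norm_minus_commute)
      next
        fix u u' assume u: "u \<in> verts H'" "u' \<in> verts H'" "{u, u'} \<in> edges H"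
        show "norm (point (F u) - point (F u')) = 1"
          unfolding Fu[OF u(1)] Fu[OF u(2)] using adj u old[OF u(1,2)] by blast
      qed (use loop in simp)
      show "\<forall>u\<in>verts H. \<forall>u'\<in>verts H. u \<noteq> u' \<longrightarrow> {u, u'} \<notin> edges H \<longrightarrow>
        (\<exists>i j. i \<noteq> j \<and> F u i \<noteq> F u' i \<and> F u j \<noteq> F u' j)"
      proof (unfold split, intro conjI ballI impI)
        fix u u' assume "u \<in> verts H'" "u' \<in> verts H'" "u \<noteq> u'" "{u, u'} \<notin> edges H"
        then show "\<exists>i j. i \<noteq> j \<and> F u i \<noteq> F u' i \<and> F u j \<noteq> F u' j"
          using far old by (simp add: Fu)
      next
        fix u assume "u \<in> verts H'" "{v, u} \<notin> edges H"
        then show "\<exists>i j. i \<noteq> j \<and> F v i \<noteq> F u i \<and> F v j \<noteq> F u j"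
          using wfar by (simp add: Fu Fv)
      next
        fix u assume u: "u \<in> verts H'" "{u, v} \<notin> edges H"
        then have "{v, u} \<notin> edges H" by (simp add: insert_commute)
        then obtain i j where "i \<noteq> j" "w i \<noteq> f u i" "w j \<noteq> f u j" using wfar u by blast
        then show "\<exists>i j. i \<noteq> j \<and> F u i \<noteq> F v i \<and> F u j \<noteq> F v j"
          using u by (intro exI[of _ i] exI[of _ j]) (auto simp: Fu Fv)
      qed simp
    qed
  qed
  \<comment> \<open>One coordinate beyond J has to be spare, since an isolated vertex consumes two
    in succession.\<close>
  have cardJ: "card J + 1 < p" using J(2) card Suc.prems(4) by linarith
  show ?case
  proof (cases "\<exists>u. {v, u} \<in> edges H")
    case True
    then obtain u where u: "{v, u} \<in> edges H" by blast
    have uH: "u \<in> verts H'" using Suc.prems(2) u by (auto simp: H')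
    have "f u \<in> U" "card J < p" using fU uH cardJ by auto
    then obtain i x where ix: "i < m" "i \<notin> J" "(f u)(i := x) \<in> U" "x \<noteq> f u i"
      "norm (point ((f u)(i := x)) - point (f u)) = 1" "col ((f u)(i := x)) = col (f u)"
      using new_direction[OF U(1) U(3) _ J(1)] by metis
    have same: "f u' i = f u i" if "u' \<in> verts H'" for u' using diff ix(2) that uH by blast
    show ?thesis
    proof (rule extend[of "(f u)(i := x)" "insert i J"])
      show "(f u)(i := x) \<in> U" "finite (insert i J)" "J \<subseteq> insert i J" using ix J by auto
      show "card (insert i J) \<le> card J + 2" using J by (simp add: card_insert_if)
      show "\<forall>u'\<in>verts H'. col ((f u)(i := x)) = col (f u')" using ix(6) col uH by metis
      show "\<forall>u'\<in>verts H'. \<forall>j. ((f u)(i := x)) j \<noteq> f u' j \<longrightarrow> j < m \<and> j \<in> insert i J"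
        using diff uH ix(1) by auto
      show "\<forall>u'\<in>verts H'. (f u)(i := x) \<noteq> f u'" using same ix(4) by (metis fun_upd_same)
      show "\<forall>u'\<in>verts H'. {v, u'} \<in> edges H \<longrightarrow> norm (point ((f u)(i := x)) - point (f u')) = 1"
        using deg u ix(5) by blast
      show "\<forall>u'\<in>verts H'. {v, u'} \<notin> edges H \<longrightarrow>
        (\<exists>j k. j \<noteq> k \<and> ((f u)(i := x)) j \<noteq> f u' j \<and> ((f u)(i := x)) k \<noteq> f u' k)"
      proof (intro ballI impI)
        fix u' assume u': "u' \<in> verts H'" "{v, u'} \<notin> edges H"
        then have "u' \<noteq> u" using u by auto
        then have "f u \<noteq> f u'" using inj[rule_format, OF uH u'(1)] by metis
        then obtain j where j: "f u j \<noteq> f u' j" by (meson ext)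
        then have "j \<noteq> i" using diff[rule_format, OF uH u'(1) j] ix(2) by auto
        then show "\<exists>j k. j \<noteq> k \<and> ((f u)(i := x)) j \<noteq> f u' j \<and> ((f u)(i := x)) k \<noteq> f u' k"
          using j same[OF u'(1)] ix(4) by (intro exI[of _ j] exI[of _ i]) auto
      qed
    qed
  next
    case isolated: False
    show ?thesis
    proof (cases "verts H' = {}")
      case True
      obtain w where "w \<in> U" using U(2) by blast
      then show ?thesis using True J by (intro extend[of w J]) auto
    next
      case False
      \<comment> \<open>Any image serves as a start: it fixes the color, and the two changes of
        letters preserve it.\<close>
      then obtain u where uH: "u \<in> verts H'" by blast
      have "f u \<in> U" "card J < p" using fU uH cardJ by auto
      then obtain i x where ix: "i < m" "i \<notin> J" "(f u)(i := x) \<in> U" "x \<noteq> f u i"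
        "col ((f u)(i := x)) = col (f u)"
        using new_direction[OF U(1) U(3) _ J(1)] by metis
      define w1 where "w1 = (f u)(i := x)"
      have "finite (insert i J)" "card (insert i J) < p" using J cardJ by (auto simp: card_insert_if)
      then obtain j y where jy: "j < m" "j \<notin> insert i J" "w1(j := y) \<in> U" "y \<noteq> w1 j"
        "col (w1(j := y)) = col w1"
        using new_direction[OF U(1) U(3) ix(3)[folded w1_def]] by metis
      define w where "w = w1(j := y)"
      have w_i: "w i = x" and w_j: "w j = y" and w_k: "\<And>k. k \<noteq> i \<Longrightarrow> k \<noteq> j \<Longrightarrow> w k = f u k"
        using jy(2) by (auto simp: w_def w1_def)
      have same: "f u' k = f u k" if "u' \<in> verts H'" "k \<notin> J" for u' k
        using diff[rule_format, OF that(1) uH, of k] that(2) by auto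
      have ne_i: "w i \<noteq> f u' i" and ne_j: "w j \<noteq> f u' j" if "u' \<in> verts H'" for u'
        using same[OF that] ix(2,4) jy(2,4) by (auto simp: w_i w_j w1_def)
      show ?thesis
      proof (rule extend[of w "insert j (insert i J)"])
        show "w \<in> U" "finite (insert j (insert i J))" "J \<subseteq> insert j (insert i J)"
          using jy J by (auto simp: w_def)
        show "card (insert j (insert i J)) \<le> card J + 2" using J by (simp add: card_insert_if)
        show "\<forall>u'\<in>verts H'. col w = col (f u')" using ix(5) jy(5) col uH unfolding w_def w1_def by metis
        show "\<forall>u'\<in>verts H'. \<forall>k. w k \<noteq> f u' k \<longrightarrow> k < m \<and> k \<in> insert j (insert i J)"
        proof (intro ballI allI impI)
          fix u' k assume "u' \<in> verts H'" "w k \<noteq> f u' k"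
          then show "k < m \<and> k \<in> insert j (insert i J)"
            using diff uH ix(1) jy(1) w_k[of k] by (cases "k = i"; cases "k = j") auto
        qed
        show "\<forall>u'\<in>verts H'. w \<noteq> f u'" using ne_i by auto
        show "\<forall>u'\<in>verts H'. {v, u'} \<in> edges H \<longrightarrow> norm (point w - point (f u')) = 1"
          using isolated by blast
        show "\<forall>u'\<in>verts H'. {v, u'} \<notin> edges H \<longrightarrow>
          (\<exists>k k'. k \<noteq> k' \<and> w k \<noteq> f u' k \<and> w k' \<noteq> f u' k')"
          using ne_i ne_j jy(2) by (metis insertI1)
      qed
    qed
  qed
qed

end

theorem monochromatic_forest:
  fixes V :: "(real ^ 'n) set" and c :: "real ^ 'n \<Rightarrow> nat" and F :: "'v ugraph"
  assumes n: "CARD('n) \<ge> 2" and V: "finite V" and c: "coloring r c" and F: "is_forest F"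
    and not_colorable: "\<nexists>d :: real ^ 'n \<Rightarrow> nat. (\<forall>x\<in>V. d x < r) \<and> (\<forall>x\<in>V. \<forall>y\<in>V. dist x y = 1 \<longrightarrow> d x \<noteq> d y)"
  shows "\<exists>A. induced_unit_copy F A \<and> monochromatic c A"
proof -
  have ne: "V \<noteq> {}" using not_colorable by auto
  \<comment> \<open>p bounds the number of coordinates that the embedding uses, and m is just above
    the threshold of \<open>many_directions_subset\<close>.\<close>
  define p where "p = 2 * card (verts F)"
  define m where "m = 2 * p * (card V)\<^sup>2 + 1"
  obtain T where "generic_words V m T" using generic_words_exists[OF V n] by blast
  then interpret generic_words V m T .
  have mono: "\<exists>x\<in>V. \<exists>y\<in>V. norm (x - y) = 1 \<and> c (point (w(i := x))) = c (point (w(i := y)))" for w i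
  proof (rule ccontr)
    assume "\<not> ?thesis"
    then have "(\<forall>x\<in>V. c (point (w(i := x))) < r) \<and>
      (\<forall>x\<in>V. \<forall>y\<in>V. dist x y = 1 \<longrightarrow> c (point (w(i := x))) \<noteq> c (point (w(i := y))))"
      using c by (simp add: coloring_def dist_norm)
    then show False
      using not_colorable[unfolded not_ex, THEN spec, of "\<lambda>x. c (point (w(i := x)))"] by (rule notE[rotated])
  qed
  have "\<exists>U\<subseteq>words. U \<noteq> {} \<and> (\<forall>w\<in>U. p \<le> card (directions (\<lambda>w. c (point w)) U w))"
    by (rule many_directions_subset[OF V ne]) (simp add: m_def, rule mono)
  then obtain U where U: "U \<subseteq> words" "U \<noteq> {}" "\<forall>w\<in>U. p \<le> card (directions (\<lambda>w. c (point w)) U w)"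
    by blast
  have F': "finite (verts F)" "\<forall>e\<in>edges F. e \<subseteq> verts F \<and> card e = 2" "\<nexists>vs. is_cycle F vs"
    using F by (auto simp: is_forest_def simple_graph_def)
  have "2 * card (verts F) \<le> p" by (simp add: p_def)
  from forest_words[OF U F' this] obtain f J where fU: "\<forall>u\<in>verts F. f u \<in> U"
    and col: "\<forall>u\<in>verts F. \<forall>u'\<in>verts F. c (point (f u)) = c (point (f u'))"
    and diff: "\<forall>u\<in>verts F. \<forall>u'\<in>verts F. \<forall>i. f u i \<noteq> f u' i \<longrightarrow> i < m \<and> i \<in> J"
    and inj: "\<forall>u\<in>verts F. \<forall>u'\<in>verts F. u \<noteq> u' \<longrightarrow> f u \<noteq> f u'"
    and adj: "\<forall>u\<in>verts F. \<forall>u'\<in>verts F. {u, u'} \<in> edges F \<longrightarrow> norm (point (f u) - point (f u')) = 1"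
    and far: "\<forall>u\<in>verts F. \<forall>u'\<in>verts F. u \<noteq> u' \<longrightarrow> {u, u'} \<notin> edges F \<longrightarrow>
      (\<exists>i j. i \<noteq> j \<and> f u i \<noteq> f u' i \<and> f u j \<noteq> f u' j)"
    by (elim exE conjE)
  have fw: "f u \<in> words" if "u \<in> verts F" for u using that fU U(1) by blast
  have "inj_on (\<lambda>u. point (f u)) (verts F)"
  proof (rule inj_onI, rule ccontr)
    fix u u' assume "u \<in> verts F" "u' \<in> verts F" "point (f u) = point (f u')" "u \<noteq> u'"
    then show False using inj fw inj_onD[OF inj_on_point] by blast
  qed
  then have "bij_betw (\<lambda>u. point (f u)) (verts F) ((\<lambda>u. point (f u)) ` verts F)"
    by (rule inj_on_imp_bij_betw)
  moreover have "norm (point (f u) - point (f u')) \<noteq> 1"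
    if "u \<in> verts F" "u' \<in> verts F" "{u, u'} \<notin> edges F" for u u'
  proof (cases "u = u'")
    case False
    from far[rule_format, OF that(1,2) False that(3)]
    obtain i j where ij: "i \<noteq> j" "f u i \<noteq> f u' i" "f u j \<noteq> f u' j" by (elim exE conjE)
    then have "i < m" "j < m" using diff[rule_format, OF that(1,2)] by auto
    then have "norm (point (f u) - point (f u')) \<notin> {0, 1}"
      using norm_point_far[OF fw[OF that(1)] fw[OF that(2)]] ij by metis
    then show ?thesis by simp
  qed simp
  ultimately have "induced_unit_copy F ((\<lambda>u. point (f u)) ` verts F)"
    unfolding induced_unit_copy_def using adj by (intro exI[of _ "\<lambda>u. point (f u)"]) blast
  moreover have "monochromatic c ((\<lambda>u. point (f u)) ` verts F)"
  proof (cases "verts F = {}")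
    case False
    then obtain u0 where "u0 \<in> verts F" by blast
    then show ?thesis unfolding monochromatic_def using col by blast
  qed (simp add: monochromatic_def)
  ultimately show ?thesis by blast
qed

section \<open>Euclidean chromatic numbers\<close>

lemma chi_space_coloring:
  obtains c :: "real ^ 'n \<Rightarrow> nat" where "coloring (chi_space TYPE('n)) c"
    "\<forall>x y. dist x y = 1 \<longrightarrow> c x \<noteq> c y"
proof -
  have "\<exists>c :: real ^ 'n \<Rightarrow> nat. coloring (chi_space TYPE('n)) c \<and> (\<forall>x y. dist x y = 1 \<longrightarrow> c x \<noteq> c y)"
    unfolding chi_space_def by (rule LeastI_ex) (rule finite_proper_coloring_exists)
  then show ?thesis using that by blast
qed

lemma chi_space_pos: "chi_space TYPE('n::finite) > 0"
proof -
  obtain c :: "real ^ 'n \<Rightarrow> nat" where "coloring (chi_space TYPE('n)) c" by (rule chi_space_coloring)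
  then show ?thesis by (metis coloring_def gr0I not_less0)
qed

text \<open>The passage from the whole space to a finite set, by contraposition of
  \<open>de_Bruijn_Erdos\<close>.\<close>

lemma finite_not_colorable:
  assumes "r < chi_space TYPE('n::finite)"
  obtains V :: "(real ^ 'n) set" where "finite V"
    "\<nexists>d :: real ^ 'n \<Rightarrow> nat. (\<forall>x\<in>V. d x < r) \<and> (\<forall>x\<in>V. \<forall>y\<in>V. dist x y = 1 \<longrightarrow> d x \<noteq> d y)"
proof (rule ccontr)
  assume contra: "\<not> thesis"
  have "\<exists>d :: real ^ 'n \<Rightarrow> nat. (\<forall>x. d x < r) \<and> (\<forall>x y. dist x y = 1 \<longrightarrow> d x \<noteq> d y)"
    using contra that by (intro de_Bruijn_Erdos) blast
  then have "\<exists>d :: real ^ 'n \<Rightarrow> nat. coloring r d \<and> (\<forall>x y. dist x y = 1 \<longrightarrow> d x \<noteq> d y)"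
    by (simp add: coloring_def)
  then show False using assms not_less_Least unfolding chi_space_def by blast
qed

lemma induced_imp_unit_copy: "induced_unit_copy H A \<Longrightarrow> unit_copy H A"
  unfolding induced_unit_copy_def unit_copy_def by blast

text \<open>The hypothesis \<open>mono\<close> is the lower bound. For the upper bound one proper
  coloring of space excludes copies of both kinds, since H has an edge.\<close>

lemma chi_eq_chi_space:
  fixes H :: "'v ugraph"
  assumes edge: "u \<in> verts H" "v \<in> verts H" "{u, v} \<in> edges H"
    and mono: "\<And>r (c :: real ^ 'n \<Rightarrow> nat). r < chi_space TYPE('n) \<Longrightarrow> coloring r c \<Longrightarrow>
      \<exists>A. induced_unit_copy H A \<and> monochromatic c A"
  shows "chi_ind_graph TYPE('n) H = chi_space TYPE('n)" "chi_graph TYPE('n) H = chi_space TYPE('n)"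
proof -
  obtain c :: "real ^ 'n \<Rightarrow> nat" where c: "coloring (chi_space TYPE('n)) c"
    "\<forall>x y. dist x y = 1 \<longrightarrow> c x \<noteq> c y" by (rule chi_space_coloring)
  have no: "\<not> (unit_copy H A \<and> monochromatic c A)" for A
  proof
    assume h: "unit_copy H A \<and> monochromatic c A"
    then obtain f where f: "bij_betw f (verts H) A" "norm (f u - f v) = 1"
      using edge unfolding unit_copy_def by blast
    then have "f u \<in> A" "f v \<in> A" using edge by (auto simp: bij_betw_def)
    then have "c (f u) = c (f v)" using h by (metis monochromatic_def)
    then show False using c(2) f(2) by (simp add: dist_norm)
  qed
  show "chi_graph TYPE('n) H = chi_space TYPE('n)"
    unfolding chi_graph_def
  proof (rule Least_equality)
    show "0 < chi_space TYPE('n) \<and> (\<exists>c :: real ^ 'n \<Rightarrow> nat. coloring (chi_space TYPE('n)) c \<and>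
      (\<nexists>A. unit_copy H A \<and> monochromatic c A))"
      using chi_space_pos c(1) no by blast
    fix r assume "0 < r \<and> (\<exists>c :: real ^ 'n \<Rightarrow> nat. coloring r c \<and> (\<nexists>A. unit_copy H A \<and> monochromatic c A))"
    then show "chi_space TYPE('n) \<le> r" using mono induced_imp_unit_copy by (meson not_le)
  qed
  show "chi_ind_graph TYPE('n) H = chi_space TYPE('n)"
    unfolding chi_ind_graph_def
  proof (rule Least_equality)
    show "0 < chi_space TYPE('n) \<and> (\<exists>c :: real ^ 'n \<Rightarrow> nat. coloring (chi_space TYPE('n)) c \<and>
      (\<nexists>A. induced_unit_copy H A \<and> monochromatic c A))"
      using chi_space_pos c(1) no induced_imp_unit_copy by blast
    fix r assume "0 < r \<and> (\<exists>c :: real ^ 'n \<Rightarrow> nat. coloring r c \<and> (\<nexists>A. induced_unit_copy H A \<and> monochromatic c A))"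
    then show "chi_space TYPE('n) \<le> r" using mono by (meson not_le)
  qed
qed

text \<open>Points at distance 1 with the same merged color have colors of different parity. Parity
  would alternate around the cycle, which an odd number of steps forbids.\<close>

lemma no_monochromatic_odd_cycle:
  fixes c :: "real ^ 'n \<Rightarrow> nat"
  assumes c: "\<forall>x y. dist x y = 1 \<longrightarrow> c x \<noteq> c y"
  shows "\<not> (unit_copy (cycle_graph (2 * l + 1)) A \<and> monochromatic (\<lambda>x. c x div 2) A)"
proof
  assume h: "unit_copy (cycle_graph (2 * l + 1)) A \<and> monochromatic (\<lambda>x. c x div 2) A"
  then obtain f where f: "bij_betw f {..<2 * l + 1} A"
    and adj: "\<And>u v. u < 2 * l + 1 \<Longrightarrow> v < 2 * l + 1 \<Longrightarrow> {u, v} \<in> edges (cycle_graph (2 * l + 1)) \<Longrightarrow>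
      norm (f u - f v) = 1"
    unfolding unit_copy_def by (auto simp: cycle_graph_def)
  have flip: "even (c (f i)) \<noteq> even (c (f (Suc i mod (2 * l + 1))))" if i: "i < 2 * l + 1" for i
  proof
    assume par: "even (c (f i)) = even (c (f (Suc i mod (2 * l + 1))))"
    have j: "Suc i mod (2 * l + 1) < 2 * l + 1" by simp
    then have "f i \<in> A" "f (Suc i mod (2 * l + 1)) \<in> A" using f i by (auto simp: bij_betw_def)
    then have "c (f i) div 2 = c (f (Suc i mod (2 * l + 1))) div 2" using h by (metis monochromatic_def)
    with par have "c (f i) = c (f (Suc i mod (2 * l + 1)))" by presburger
    moreover have "norm (f i - f (Suc i mod (2 * l + 1))) = 1"
      by (rule adj[OF i j]) (rule iffD2[OF cycle_graph_edge_iff[OF i j]], rule disjI1, rule refl)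
    ultimately show False using c by (simp add: dist_norm)
  qed
  have "even (c (f i)) \<longleftrightarrow> (even (c (f 0)) \<longleftrightarrow> even i)" if "i < 2 * l + 1" for i
    using that
  proof (induction i)
    case (Suc i)
    then have "Suc i mod (2 * l + 1) = Suc i" by simp
    then show ?case using flip[of i] Suc by auto
  qed simp
  from this[of "2 * l"] flip[of "2 * l"] show False by simp
qed

text \<open>A single finite V that is not 2 (K - 1)-colorable serves all l at once, so the bound
  \<open>card V + 6\<close> depends on n alone. A coloring with fewer than K colors is also one with
  K - 1 colors.\<close>

lemma chi_graph_odd_cycle:
  assumes n: "CARD('n::finite) \<ge> 2"
  shows "\<exists>l0. \<forall>l\<ge>l0. chi_graph TYPE('n) (cycle_graph (2 * l + 1)) = (chi_space TYPE('n) + 1) div 2"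
proof -
  define K where "K = (chi_space TYPE('n) + 1) div 2"
  have K: "K > 0" "2 * (K - 1) < chi_space TYPE('n)" using chi_space_pos[where 'n = 'n] unfolding K_def by linarith+
  obtain V :: "(real ^ 'n) set" where V: "finite V"
    "\<nexists>d :: real ^ 'n \<Rightarrow> nat. (\<forall>x\<in>V. d x < 2 * (K - 1)) \<and> (\<forall>x\<in>V. \<forall>y\<in>V. dist x y = 1 \<longrightarrow> d x \<noteq> d y)"
    using K(2) by (rule finite_not_colorable)
  obtain c :: "real ^ 'n \<Rightarrow> nat" where c: "coloring (chi_space TYPE('n)) c"
    "\<forall>x y. dist x y = 1 \<longrightarrow> c x \<noteq> c y" by (rule chi_space_coloring)
  have half: "coloring K (\<lambda>x. c x div 2)"
    unfolding coloring_def
  proof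
    fix x
    have "c x < chi_space TYPE('n)" using c(1) by (simp add: coloring_def)
    then show "c x div 2 < K" unfolding K_def by linarith
  qed
  have "chi_graph TYPE('n) (cycle_graph (2 * l + 1)) = K" if l: "l \<ge> card V + 6" for l
    unfolding chi_graph_def
  proof (rule Least_equality)
    show "0 < K \<and> (\<exists>c :: real ^ 'n \<Rightarrow> nat. coloring K c \<and>
      (\<nexists>A. unit_copy (cycle_graph (2 * l + 1)) A \<and> monochromatic c A))"
      using K(1) half no_monochromatic_odd_cycle[OF c(2)] by blast
    fix r assume r: "0 < r \<and> (\<exists>c :: real ^ 'n \<Rightarrow> nat. coloring r c \<and>
      (\<nexists>A. unit_copy (cycle_graph (2 * l + 1)) A \<and> monochromatic c A))"
    show "K \<le> r"
    proof (rule ccontr)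
      assume "\<not> K \<le> r"
      obtain d :: "real ^ 'n \<Rightarrow> nat" where d: "coloring r d"
        "\<nexists>A. unit_copy (cycle_graph (2 * l + 1)) A \<and> monochromatic d A" using r by blast
      have "r \<le> K - 1" using \<open>\<not> K \<le> r\<close> by simp
      then have "coloring (K - 1) d" using d(1) unfolding coloring_def by (meson less_le_trans)
      from monochromatic_odd_cycle[OF n V(1) this l V(2)] show False using d(2) by blast
    qed
  qed
  then show ?thesis unfolding K_def by blast
qed

theorem theorem1p1:
  assumes "CARD('n::finite) \<ge> 2"
  shows "(\<forall>F :: 'v ugraph. is_forest F \<longrightarrow>
            chi_ind_graph TYPE('n) F = chi_graph TYPE('n) F \<and>
            chi_graph TYPE('n) F = chi_space TYPE('n)) \<and>
         (\<forall>l::nat. l = 4 \<or> l \<ge> 6 \<longrightarrow>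
            chi_ind_graph TYPE('n) (cycle_graph (2 * l)) = chi_graph TYPE('n) (cycle_graph (2 * l)) \<and>
            chi_graph TYPE('n) (cycle_graph (2 * l)) = chi_space TYPE('n)) \<and>
         (\<exists>l0::nat. \<forall>l\<ge>l0.
            int (chi_graph TYPE('n) (cycle_graph (2 * l + 1))) =
              \<lceil>real (chi_space TYPE('n)) / 2\<rceil>)"
proof (intro conjI allI impI)
  fix F :: "'v ugraph" assume F: "is_forest F"
  then obtain e where "e \<in> edges F" "e \<subseteq> verts F" "card e = 2"
    by (auto simp: is_forest_def simple_graph_def)
  then obtain u v where e: "u \<in> verts F" "v \<in> verts F" "{u, v} \<in> edges F" by (auto simp: card_2_iff)
  have mono: "\<exists>A. induced_unit_copy F A \<and> monochromatic c A"
    if r: "r < chi_space TYPE('n)" "coloring r c" for r and c :: "real ^ 'n \<Rightarrow> nat"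
  proof -
    obtain V :: "(real ^ 'n) set" where V: "finite V"
      "\<nexists>d :: real ^ 'n \<Rightarrow> nat. (\<forall>x\<in>V. d x < r) \<and> (\<forall>x\<in>V. \<forall>y\<in>V. dist x y = 1 \<longrightarrow> d x \<noteq> d y)"
      using r(1) by (rule finite_not_colorable)
    show ?thesis by (rule monochromatic_forest[OF assms V(1) r(2) F V(2)])
  qed
  show "chi_ind_graph TYPE('n) F = chi_graph TYPE('n) F" "chi_graph TYPE('n) F = chi_space TYPE('n)"
    using chi_eq_chi_space[OF e mono] by simp_all
next
  fix l :: nat assume l: "l = 4 \<or> l \<ge> 6"
  then have e: "0 \<in> verts (cycle_graph (2 * l))" "1 \<in> verts (cycle_graph (2 * l))"
    "{0, 1} \<in> edges (cycle_graph (2 * l))"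
    using cycle_graph_edge_iff[of 0 "2 * l" 1] by (auto simp: cycle_graph_def)
  have mono: "\<exists>A. induced_unit_copy (cycle_graph (2 * l)) A \<and> monochromatic c A"
    if r: "r < chi_space TYPE('n)" "coloring r c" for r and c :: "real ^ 'n \<Rightarrow> nat"
  proof -
    obtain V :: "(real ^ 'n) set" where V: "finite V"
      "\<nexists>d :: real ^ 'n \<Rightarrow> nat. (\<forall>x\<in>V. d x < r) \<and> (\<forall>x\<in>V. \<forall>y\<in>V. dist x y = 1 \<longrightarrow> d x \<noteq> d y)"
      using r(1) by (rule finite_not_colorable)
    show ?thesis by (rule monochromatic_even_cycle[OF assms V(1) r(2) l V(2)])
  qed
  show "chi_ind_graph TYPE('n) (cycle_graph (2 * l)) = chi_graph TYPE('n) (cycle_graph (2 * l))"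
    "chi_graph TYPE('n) (cycle_graph (2 * l)) = chi_space TYPE('n)"
    using chi_eq_chi_space[OF e mono] by simp_all
next
  have "int ((k + 1) div 2) = \<lceil>real k / 2\<rceil>" for k :: nat
    by (rule ceiling_unique[symmetric]; cases "even k") (auto elim!: evenE oddE)
  then show "\<exists>l0. \<forall>l\<ge>l0. int (chi_graph TYPE('n) (cycle_graph (2 * l + 1))) =
    \<lceil>real (chi_space TYPE('n)) / 2\<rceil>"
    using chi_graph_odd_cycle[OF assms] by metis
qed

end
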